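(* Let $S$ be a standard graded polynomial ring over a field $K$ in finitely many variables, and let $M\ne 0$ be a finitely generated graded $d$-dimensional $S$-module with Macaulay constants $b_i=b_i(M)$. The Hilbert polynomial $p_M \in \mathbb Q[z]$ of $M$ is \[ p_M(z) = \sum_{j=1}^d\ \sum_{k=b_{j+1}}^{b_j-1} \binom{z-k+j-1}{j-1}, \] which can also be written as \[ p_M(z) = \sum_{j=1}^d \left[\binom{z-e^+(M)+j-1}{j} - \binom{z-b_j+j-1}{j}\right]. \] Moreover, if $d \ge 1$ then the Macaulay constants $b_1(M),\ldots,b_d(M)$ are uniquely determined by $e^+(M)$ and $p_M$.
   Context: **Setting.** $K$ is any field, $S=K[X]$ is the polynomial ring with finite variable set $X$ and standard grading (all variables have degree one). Graded means $\mathbb Z$-graded. Dimension is Krull dimension. For a finitely generated graded $S$-module $M\ne 0$, $e^+(M)$ is the maximum degree of a minimal generator of $M$, and $p_M\in\mathbb Q[z]$ is the polynomial with $p_M(j)=\dim_K[M]_j$ for all $j\gg0$. Empty sums (in particular $\sum_{j=a}^{b}$ with $b<a$) are zero. For integers $c$ and $j\ge0$, $\binom{z+c}{j}\in\mathbb Q[z]$ is the polynomial $\frac{(z+c)(z+c-1)\cdots(z+c-j+1)}{j!}$ of degree $j$ (equal to $1$ if $j=0$). **Cone decompositions.** Given $M\neq 0$, choose a minimal epimorphism $\varphi: F\to M$: $F$ is graded free with a homogeneous basis mapped bijectively and degree-preservingly onto a homogeneous minimal generating set of $M$. Put $Q=\ker\varphi$, fix a monomial order $<$ on $F$, and let $N_M\subseteq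 F$ be the $K$-span of the monomials of $F$ not in $\operatorname{in}_<(Q)$; then $N_M\cong M$ as graded $K$-vector spaces. A cone is a subspace $hK[U]\subseteq F$ with $0\ne h\in F$ homogeneous and $U\subseteq X$; its dimension is $|U|$. A cone decomposition of $M$ is a finite direct sum decomposition $N_M=\bigoplus_{i=1}^s h_iK[U_i]$ into cones. It is $q$-standard if (a) $\deg h_i\ge q$ whenever $U_i\ne\emptyset$, and (b) for every $i$ with $U_i\neq\emptyset$ and every integer $c$ with $q\le c\le\deg h_i$ there is some $j$ with $\deg h_j=c$ and $|U_j|\ge|U_i|$. It is $q$-exact if it is $q$-standard and $\deg h_i\ne\deg h_j$ for all $i\ne j$ with $U_i\ne\emptyset\ne U_j$. Every $M \ne 0$ admits an $e^+(M)$-exact cone decomposition. **Macaulay constants.** Let $d=\dim M$ and let $P$ be an $e^+(M)$-exact cone decomposition of $M$. It has the form \[ P=\bigoplus_{k=1}^{s}h_{k,0}K\ \oplus\ \bigoplus_{j=1}^{d}\ \bigoplus_{k=b_{j+1}}^{b_j-1}h_{k,j}K[U_{k,j}], \] where $|U_{k,j}|=j$, $\deg h_{k,j}=k$ if $j\ge1$, and, if $d\ge 1$, $b_1\ge\cdots\ge b_{d+1}=e^+(M)$. Let $b_0$ be $1$ plus the maximum degree of all cone generators in $P$; if $d=0$, put $b_1=e^+(M)$. The integers $b_i(M):=b_i$, $0\le i\le d+1$, are the Macaulay constants of $M$; they are independent of the choices. *)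

theory Defs
  imports
    "HOL-Library.Poly_Mapping"
    "HOL-Library.Extended_Nat"
    "HOL-Computational_Algebra.Polynomial"
    "HOL-Algebra.QuotRing"
    "HOL-Algebra.Module"
begin

abbreviation "keys \<equiv> Poly_Mapping.keys"
abbreviation "lookup \<equiv> Poly_Mapping.lookup"

section \<open>The polynomial ring \<open>S = K[X]\<close>\<close>

text \<open>
  The field is a type \<open>'k\<close> of class \<^class>\<open>field\<close>. A monomial is an exponent function
  \<open>\<alpha> :: 'x \<Rightarrow>\<^sub>0 nat\<close> and a polynomial is a finitely supported function on monomials, with the
  convolution product of \<^theory>\<open>HOL-Library.Poly_Mapping\<close>. The variable set is a set \<open>X\<close>
  rather than a type so that subrings \<open>K[U]\<close>, \<open>U \<subseteq> X\<close>, and \<open>X = {}\<close> are covered.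
\<close>

type_synonym ('x, 'k) mpoly = "('x \<Rightarrow>\<^sub>0 nat) \<Rightarrow>\<^sub>0 'k"

definition poly_ring :: "'x set \<Rightarrow> ('x, 'k::field) mpoly ring" where
  "poly_ring X =
    \<lparr>carrier = {p. \<forall>\<alpha>\<in>keys p. keys \<alpha> \<subseteq> X}, mult = (*), one = 1, zero = 0, add = (+)\<rparr>"

definition mdeg :: "('x \<Rightarrow>\<^sub>0 nat) \<Rightarrow> nat" where
  "mdeg \<alpha> = (\<Sum>x\<in>keys \<alpha>. lookup \<alpha> x)"

definition poly_comp :: "'x set \<Rightarrow> nat \<Rightarrow> ('x, 'k::field) mpoly set" where
  "poly_comp X i = {p \<in> carrier (poly_ring X). \<forall>\<alpha>\<in>keys p. mdeg \<alpha> = i}"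

definition const :: "'k \<Rightarrow> ('x, 'k::field) mpoly" where
  "const c = Poly_Mapping.single 0 c"


section \<open>Finitely generated graded modules\<close>

text \<open>\<open>Gr a\<close> is the component of degree \<open>a\<close>; negative components of \<open>S\<close> are zero.\<close>

locale graded_module =
  fixes X :: "'x set" and M :: "(('x, 'k::field) mpoly, 'm) module" and Gr :: "int \<Rightarrow> 'm set"
  assumes finite_vars: "finite X"
    and module: "module (poly_ring X) M"
    and comp_subgroup: "\<And>a. additive_subgroup (Gr a) M"
    and comp_smult:
      "\<And>i a p m. p \<in> poly_comp X i \<Longrightarrow> m \<in> Gr a \<Longrightarrow> p \<odot>\<^bsub>M\<^esub> m \<in> Gr (int i + a)"
    and direct_sum:
      "\<And>m. m \<in> carrier M \<Longrightarrow>
        \<exists>!f. (\<forall>a. f a \<in> Gr a) \<and> finite {a. f a \<noteq> \<zero>\<^bsub>M\<^esub>} \<and>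
             m = finsum M f {a. f a \<noteq> \<zero>\<^bsub>M\<^esub>}"

definition generated_submodule :: "('r, 's) ring_scheme \<Rightarrow> ('r, 'm) module \<Rightarrow> 'm set \<Rightarrow> 'm set" where
  "generated_submodule R M B = \<Inter>{N. submodule N R M \<and> B \<subseteq> N}"

definition finitely_generated :: "('r, 's) ring_scheme \<Rightarrow> ('r, 'm) module \<Rightarrow> bool" where
  "finitely_generated R M \<longleftrightarrow>
    (\<exists>B. finite B \<and> B \<subseteq> carrier M \<and> generated_submodule R M B = carrier M)"

text \<open>The degree of a nonzero homogeneous element.\<close>

definition hdeg :: "(int \<Rightarrow> 'm set) \<Rightarrow> 'm \<Rightarrow> int" where
  "hdeg Gr m = (THE a. m \<in> Gr a)"

definition minimal_hom_gens ::
    "'x set \<Rightarrow> (('x, 'k::field) mpoly, 'm) module \<Rightarrow> (int \<Rightarrow> 'm set) \<Rightarrow> 'm set \<Rightarrow> bool" where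
  "minimal_hom_gens X M Gr G \<longleftrightarrow>
    finite G \<and> G \<subseteq> (\<Union>a. Gr a) \<and>
    generated_submodule (poly_ring X) M G = carrier M \<and>
    (\<forall>G'. G' \<subset> G \<longrightarrow> generated_submodule (poly_ring X) M G' \<noteq> carrier M)"

text \<open>\<open>e\<^sup>+(M)\<close>\<close>

definition e_plus ::
    "'x set \<Rightarrow> (('x, 'k::field) mpoly, 'm) module \<Rightarrow> (int \<Rightarrow> 'm set) \<Rightarrow> int" where
  "e_plus X M Gr = Max {hdeg Gr g | g. \<exists>G. minimal_hom_gens X M Gr G \<and> g \<in> G}"

text \<open>
  Krull dimension of a ring, and of a module as the dimension of the ring modulo the annihilator.
\<close>

definition krull_dim :: "('r, 's) ring_scheme \<Rightarrow> enat" where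
  "krull_dim R = Sup {enat n | n.
    \<exists>P :: nat \<Rightarrow> 'r set. (\<forall>i\<le>n. primeideal (P i) R) \<and> (\<forall>i<n. P i \<subset> P (Suc i))}"

definition annihilator :: "('r, 's) ring_scheme \<Rightarrow> ('r, 'm) module \<Rightarrow> 'r set" where
  "annihilator R M = {r \<in> carrier R. \<forall>m\<in>carrier M. r \<odot>\<^bsub>M\<^esub> m = \<zero>\<^bsub>M\<^esub>}"

definition module_dim :: "('r, 's) ring_scheme \<Rightarrow> ('r, 'm) module \<Rightarrow> enat" where
  "module_dim R M = krull_dim (R Quot annihilator R M)"


section \<open>Hilbert polynomial\<close>

text \<open>\<open>K\<close> acts on \<open>M\<close> through the constant polynomials.\<close>

definition is_K_basis :: "(('x, 'k::field) mpoly, 'm) module \<Rightarrow> 'm set \<Rightarrow> 'm set \<Rightarrow> bool" where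
  "is_K_basis M V B \<longleftrightarrow> finite B \<and> B \<subseteq> V \<and>
    (\<forall>v\<in>V. \<exists>!c. c \<in> B \<rightarrow>\<^sub>E (UNIV :: 'k set) \<and> v = finsum M (\<lambda>u. const (c u) \<odot>\<^bsub>M\<^esub> u) B)"

definition K_dim :: "(('x, 'k::field) mpoly, 'm) module \<Rightarrow> 'm set \<Rightarrow> nat" where
  "K_dim M V = (THE n. \<exists>B. is_K_basis M V B \<and> card B = n)"

definition hilbert_poly ::
    "(('x, 'k::field) mpoly, 'm) module \<Rightarrow> (int \<Rightarrow> 'm set) \<Rightarrow> rat poly" where
  "hilbert_poly M Gr =
    (THE p. \<forall>\<^sub>F j in at_top. poly p (of_int j) = of_nat (K_dim M (Gr j)))"

text \<open>\<open>binom_poly c j\<close> is the polynomial \<open>(z+c)(z+c-1)\<cdots>(z+c-j+1) / j!\<close>.\<close>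

definition binom_poly :: "int \<Rightarrow> nat \<Rightarrow> rat poly" where
  "binom_poly c j = Polynomial.smult (1 / fact j) (\<Prod>i<j. [:of_int c - of_nat i, 1:])"


section \<open>The free module of a minimal epimorphism\<close>

text \<open>
  For a minimal homogeneous generating set \<open>G\<close> of \<open>M\<close>, the minimal epimorphism is
  \<open>F = (\<Oplus>g\<in>G. S e\<^sub>g) \<rightarrow> M\<close>, \<open>e\<^sub>g \<mapsto> g\<close>, where \<open>e\<^sub>g\<close> has degree \<open>hdeg Gr g\<close>; the basis of \<open>F\<close> is thus
  indexed by \<open>G\<close> itself. The monomial \<open>x\<^sup>\<alpha> e\<^sub>g\<close> is represented by the pair \<open>(g, \<alpha>)\<close>. The record
  fields \<open>mult\<close> and \<open>one\<close> play no role for a module.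
\<close>

type_synonym ('x, 'k, 'm) fvec = "'m \<Rightarrow>\<^sub>0 ('x, 'k) mpoly"

definition fscale :: "('x, 'k::field) mpoly \<Rightarrow> ('x, 'k, 'm) fvec \<Rightarrow> ('x, 'k, 'm) fvec" where
  "fscale p f = Poly_Mapping.map (\<lambda>q. p * q) f"

definition free_module ::
    "'x set \<Rightarrow> 'm set \<Rightarrow> (('x, 'k::field) mpoly, ('x, 'k, 'm) fvec) module" where
  "free_module X G =
    \<lparr>carrier = {f. keys f \<subseteq> G \<and> (\<forall>g. lookup f g \<in> carrier (poly_ring X))},
     mult = undefined, one = undefined, zero = 0, add = (+), smult = fscale\<rparr>"

definition min_epi ::
    "(('x, 'k::field) mpoly, 'm) module \<Rightarrow> 'm set \<Rightarrow> ('x, 'k, 'm) fvec \<Rightarrow> 'm" where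
  "min_epi M G f = finsum M (\<lambda>g. lookup f g \<odot>\<^bsub>M\<^esub> g) G"

definition epi_kernel ::
    "'x set \<Rightarrow> (('x, 'k::field) mpoly, 'm) module \<Rightarrow> 'm set \<Rightarrow> ('x, 'k, 'm) fvec set" where
  "epi_kernel X M G = {f \<in> carrier (free_module X G). min_epi M G f = \<zero>\<^bsub>M\<^esub>}"

definition monomials :: "'x set \<Rightarrow> 'm set \<Rightarrow> ('m \<times> ('x \<Rightarrow>\<^sub>0 nat)) set" where
  "monomials X G = {(g, \<alpha>). g \<in> G \<and> keys \<alpha> \<subseteq> X}"

definition monom_vec :: "'m \<times> ('x \<Rightarrow>\<^sub>0 nat) \<Rightarrow> ('x, 'k::field, 'm) fvec" where
  "monom_vec u = Poly_Mapping.single (fst u) (Poly_Mapping.single (snd u) 1)"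

definition supp :: "('x, 'k::field, 'm) fvec \<Rightarrow> ('m \<times> ('x \<Rightarrow>\<^sub>0 nat)) set" where
  "supp f = {(g, \<alpha>). lookup (lookup f g) \<alpha> \<noteq> 0}"

definition free_comp ::
    "'x set \<Rightarrow> (int \<Rightarrow> 'm set) \<Rightarrow> 'm set \<Rightarrow> int \<Rightarrow> ('x, 'k::field, 'm) fvec set" where
  "free_comp X Gr G c =
    {f \<in> carrier (free_module X G). \<forall>(g, \<alpha>)\<in>supp f. hdeg Gr g + int (mdeg \<alpha>) = c}"

text \<open>\<open>(u, v) \<in> r\<close> means \<open>u < v\<close>.\<close>

definition monomial_order ::
    "'x set \<Rightarrow> 'm set \<Rightarrow> (('m \<times> ('x \<Rightarrow>\<^sub>0 nat)) \<times> ('m \<times> ('x \<Rightarrow>\<^sub>0 nat))) set \<Rightarrow> bool" where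
  "monomial_order X G r \<longleftrightarrow>
    r \<subseteq> monomials X G \<times> monomials X G \<and>
    strict_linear_order_on (monomials X G) r \<and>
    (\<forall>g \<alpha> g' \<alpha>' \<beta>. ((g, \<alpha>), (g', \<alpha>')) \<in> r \<and> keys \<beta> \<subseteq> X \<longrightarrow>
        ((g, \<beta> + \<alpha>), (g', \<beta> + \<alpha>')) \<in> r) \<and>
    (\<forall>g \<alpha> \<beta>. (g, \<alpha>) \<in> monomials X G \<and> keys \<beta> \<subseteq> X \<and> \<beta> \<noteq> 0 \<longrightarrow>
        ((g, \<alpha>), (g, \<beta> + \<alpha>)) \<in> r)"

definition initial_monomial ::
    "(('m \<times> ('x \<Rightarrow>\<^sub>0 nat)) \<times> ('m \<times> ('x \<Rightarrow>\<^sub>0 nat))) set \<Rightarrow> ('x, 'k::field, 'm) fvec \<Rightarrow>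
      'm \<times> ('x \<Rightarrow>\<^sub>0 nat)" where
  "initial_monomial r f = (THE u. u \<in> supp f \<and> (\<forall>v\<in>supp f. v \<noteq> u \<longrightarrow> (v, u) \<in> r))"

definition initial_module ::
    "'x set \<Rightarrow> 'm set \<Rightarrow> (('m \<times> ('x \<Rightarrow>\<^sub>0 nat)) \<times> ('m \<times> ('x \<Rightarrow>\<^sub>0 nat))) set \<Rightarrow>
      ('x, 'k::field, 'm) fvec set \<Rightarrow> ('x, 'k, 'm) fvec set" where
  "initial_module X G r Q =
    generated_submodule (poly_ring X) (free_module X G)
      {monom_vec (initial_monomial r f) | f. f \<in> Q \<and> f \<noteq> 0}"

text \<open>The space \<open>N\<^sub>M\<close> spanned over \<open>K\<close> by the monomials outside the initial module of the kernel.\<close>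

definition normal_space ::
    "'x set \<Rightarrow> (('x, 'k::field) mpoly, 'm) module \<Rightarrow> 'm set \<Rightarrow>
      (('m \<times> ('x \<Rightarrow>\<^sub>0 nat)) \<times> ('m \<times> ('x \<Rightarrow>\<^sub>0 nat))) set \<Rightarrow> ('x, 'k, 'm) fvec set" where
  "normal_space X M G r =
    {f \<in> carrier (free_module X G).
      \<forall>u\<in>supp f. (monom_vec u :: ('x, 'k, 'm) fvec) \<notin> initial_module X G r (epi_kernel X M G)}"


section \<open>Cone decompositions\<close>

text \<open>
  The pair \<open>(h, U)\<close> stands for the cone \<open>hK[U]\<close>. A decomposition is a set of such pairs: the same
  pair cannot occur twice in a direct sum, since \<open>hK[U] \<noteq> 0\<close>.
\<close>

definition cone :: "('x, 'k::field, 'm) fvec \<times> 'x set \<Rightarrow> ('x, 'k, 'm) fvec set" where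
  "cone C = {fscale p (fst C) | p. p \<in> carrier (poly_ring (snd C))}"

definition cone_decomposition ::
    "'x set \<Rightarrow> (('x, 'k::field) mpoly, 'm) module \<Rightarrow> (int \<Rightarrow> 'm set) \<Rightarrow> 'm set \<Rightarrow>
      (('m \<times> ('x \<Rightarrow>\<^sub>0 nat)) \<times> ('m \<times> ('x \<Rightarrow>\<^sub>0 nat))) set \<Rightarrow>
      (('x, 'k, 'm) fvec \<times> 'x set) set \<Rightarrow> bool" where
  "cone_decomposition X M Gr G r P \<longleftrightarrow>
    finite P \<and>
    (\<forall>(h, U)\<in>P. h \<noteq> 0 \<and> (\<exists>c. h \<in> free_comp X Gr G c) \<and> U \<subseteq> X) \<and>
    (\<forall>C\<in>P. cone C \<subseteq> normal_space X M G r) \<and>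
    (\<forall>v\<in>normal_space X M G r. \<exists>!w. w \<in> (\<Pi>\<^sub>E C\<in>P. cone C) \<and> v = (\<Sum>C\<in>P. w C))"

text \<open>The degree of a cone generator.\<close>

definition cdeg ::
    "'x set \<Rightarrow> (int \<Rightarrow> 'm set) \<Rightarrow> 'm set \<Rightarrow> ('x, 'k::field, 'm) fvec \<times> 'x set \<Rightarrow> int" where
  "cdeg X Gr G C = (THE c. fst C \<in> free_comp X Gr G c)"

definition q_standard ::
    "'x set \<Rightarrow> (int \<Rightarrow> 'm set) \<Rightarrow> 'm set \<Rightarrow> int \<Rightarrow>
      (('x, 'k::field, 'm) fvec \<times> 'x set) set \<Rightarrow> bool" where
  "q_standard X Gr G q P \<longleftrightarrow>
    (\<forall>C\<in>P. snd C \<noteq> {} \<longrightarrow> q \<le> cdeg X Gr G C) \<and>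
    (\<forall>C\<in>P. snd C \<noteq> {} \<longrightarrow> (\<forall>c. q \<le> c \<and> c \<le> cdeg X Gr G C \<longrightarrow>
        (\<exists>D\<in>P. cdeg X Gr G D = c \<and> card (snd C) \<le> card (snd D))))"

definition q_exact ::
    "'x set \<Rightarrow> (int \<Rightarrow> 'm set) \<Rightarrow> 'm set \<Rightarrow> int \<Rightarrow>
      (('x, 'k::field, 'm) fvec \<times> 'x set) set \<Rightarrow> bool" where
  "q_exact X Gr G q P \<longleftrightarrow>
    q_standard X Gr G q P \<and>
    (\<forall>C\<in>P. \<forall>D\<in>P. C \<noteq> D \<and> snd C \<noteq> {} \<and> snd D \<noteq> {} \<longrightarrow> cdeg X Gr G C \<noteq> cdeg X Gr G D)"


section \<open>Macaulay constants\<close>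

text \<open>
  \<open>macaulay_form X Gr G e d P b\<close>: the cones of \<open>P\<close> have dimension at most \<open>d\<close>, and for
  \<open>1 \<le> j \<le> d\<close> those of dimension \<open>j\<close> have exactly the degrees \<open>b\<^sub>j\<^sub>+\<^sub>1, \<dots>, b\<^sub>j - 1\<close>, each once, with
  \<open>b\<^sub>1 \<ge> \<cdots> \<ge> b\<^sub>d\<^sub>+\<^sub>1 = e\<close>. The constants are \<open>b\<^sub>0, \<dots>, b\<^sub>d\<^sub>+\<^sub>1\<close>; as \<open>b\<close> is a total function, its
  values beyond the index \<open>d + 1\<close> are set to \<open>e\<close> by convention.
\<close>

definition macaulay_form ::
    "'x set \<Rightarrow> (int \<Rightarrow> 'm set) \<Rightarrow> 'm set \<Rightarrow> int \<Rightarrow> nat \<Rightarrow>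
      (('x, 'k::field, 'm) fvec \<times> 'x set) set \<Rightarrow> (nat \<Rightarrow> int) \<Rightarrow> bool" where
  "macaulay_form X Gr G e d P b \<longleftrightarrow>
    (\<forall>C\<in>P. card (snd C) \<le> d) \<and>
    (\<forall>j\<in>{1..d}. bij_betw (cdeg X Gr G) {C\<in>P. card (snd C) = j} {b (j + 1)..<b j}) \<and>
    (\<forall>j\<in>{1..d}. b (j + 1) \<le> b j) \<and>
    (\<forall>j>d. b j = e) \<and>
    b 0 = 1 + Max (cdeg X Gr G ` P)"

text \<open>
  \<open>b\<close> are the Macaulay constants of \<open>M\<close>, read off from some choice of generators, order and
  decomposition. A relation rather than a function, so that a statement about all such \<open>b\<close>
  covers every choice.
\<close>

definition macaulay_constants ::
    "'x set \<Rightarrow> (('x, 'k::field) mpoly, 'm) module \<Rightarrow> (int \<Rightarrow> 'm set) \<Rightarrow> (nat \<Rightarrow> int) \<Rightarrow> bool" where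
  "macaulay_constants X M Gr b \<longleftrightarrow>
    (\<exists>G r P d.
      minimal_hom_gens X M Gr G \<and> monomial_order X G r \<and>
      cone_decomposition X M Gr G r P \<and> q_exact X Gr G (e_plus X M Gr) P \<and>
      module_dim (poly_ring X) M = enat d \<and>
      macaulay_form X Gr G (e_plus X M Gr) d P b)"

end

theory Submission
  imports Defs
begin

text \<open>
  By Macaulay's basis theorem the minimal epimorphism restricts to an isomorphism from \<open>N\<^sub>M\<close> onto \<open>M\<close>
  in every degree. A cone \<open>hK[U]\<close> with \<open>\<bar>U\<bar> = j\<close> and \<open>deg h = k\<close> has the \<open>K\<close>-basis \<open>x\<^sup>\<beta> h\<close>, where \<open>x\<^sup>\<beta>\<close>
  runs through the monomials in \<open>U\<close>, so beyond all generator degrees it contributes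
  \<open>binom (z - k + j - 1) (j - 1)\<close> if \<open>j \<ge> 1\<close> and nothing if \<open>j = 0\<close>; this is the first formula. The
  second one follows from it by telescoping with Pascal's rule. Writing
  \<open>A\<^sub>j(a) = binom (z - a + j - 1) j\<close>, the difference \<open>A\<^sub>j(a) - A\<^sub>j(a')\<close> has degree at most \<open>j - 1\<close> and the
  coefficient \<open>(a' - a) / (j - 1)!\<close> there, so \<open>b\<^sub>j\<close> can be read off from the Hilbert polynomial for
  descending \<open>j\<close>.
\<close>

section \<open>Binomial polynomials\<close>

text \<open>Telescoping the inner sums leaves the base degree \<open>b (j + 1) - 1\<close>, which
  depends on \<open>j\<close>. Replacing all of them by \<open>e_plus\<close> cannot be done term by
  term: \<open>mbinom j (a - 1)\<close> is the sum of all \<open>mbinom i a\<close> with i \<le> j,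
  so each index contributes to all lower ones. The resulting form is the one that uniqueness rests
  on: every summand has a single unknown constant, and summands beyond the dimension vanish, so
  modules of different dimension can be compared. On the module side, \<open>K_dim\<close> speaks
  about M with constant polynomials as scalars, while monomials live in the free module. The vectors
  of the free module form a vector space on a whole type, the linear algebra happens in its
  subspaces, and \<phi> transports bases one degree at a time. Independence of the vectors
  \<open>x^\<beta> h\<close> combines two facts: uniqueness of the decomposition separates the
  cones, and torsion-freeness of the free module separates the monomials inside one cone.\<close>

lemma poly_binom_poly: "poly (binom_poly c j) x = (x + of_int c) gchoose j"
  unfolding binom_poly_def gbinomial_prod_rev
  by (simp add: poly_prod atLeast0LessThan algebra_simps)

lemma poly_binom_poly_of_int:
  assumes "0 \<le> m + c"
  shows "poly (binom_poly c j) (of_int m) = of_nat (nat (m + c) choose j)"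
proof -
  have "(of_int m + of_int c :: rat) = of_nat (nat (m + c))"
    using assms by simp
  then show ?thesis by (simp only: poly_binom_poly binomial_gbinomial)
qed

lemma binom_poly_pascal:
  "binom_poly (c + 1) (Suc j) = binom_poly c (Suc j) + binom_poly c j"
proof -
  have "poly (binom_poly (c + 1) (Suc j)) x = poly (binom_poly c (Suc j) + binom_poly c j) x" for x
    using gbinomial_Suc_Suc[of "x + of_int c" j] by (simp add: poly_binom_poly ac_simps)
  then show ?thesis using poly_eq_poly_eq_iff by blast
qed

lemma binom_poly_zero [simp]: "binom_poly c 0 = 1"
  by (simp add: binom_poly_def one_pCons)

lemma sum_binom_poly_telescope:
  fixes a b :: int
  assumes "a \<le> b"
  shows "(\<Sum>k\<in>{a..<b}. binom_poly (c - k) j) =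
    binom_poly (c - a + 1) (Suc j) - binom_poly (c - b + 1) (Suc j)"
  using assms
proof (induction b rule: int_ge_induct)
  case base
  then show ?case by simp
next
  case (step b)
  have "{a..<b + 1} = insert b {a..<b}" using step by auto
  moreover have "binom_poly (c - b + 1) (Suc j) = binom_poly (c - b) (Suc j) + binom_poly (c - b) j"
    by (rule binom_poly_pascal)
  ultimately show ?case using step by simp
qed

section \<open>From varying base degrees to one common base degree\<close>

text \<open>This is \<open>A_j(a)\<close> from the overview. At a large integer c it counts the
  monomials of degree less than c - a in j variables.\<close>

definition mbinom :: "nat \<Rightarrow> int \<Rightarrow> rat poly" where
  "mbinom j a = binom_poly (- a + int j - 1) j"

lemma mbinom_pred: "mbinom (Suc j) (a - 1) = mbinom (Suc j) a + mbinom j (a - 1)"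
  using binom_poly_pascal[of "- a + int j" j] by (simp add: mbinom_def algebra_simps)

text \<open>Pascal's rule iterated down to index 0, where the polynomial is the constant 1 (the
  hockey-stick identity).\<close>

lemma mbinom_pred_sum: "mbinom j (a - 1) = (\<Sum>i\<le>j. mbinom i a)"
proof (induction j)
  case 0
  then show ?case by (simp add: mbinom_def)
next
  case (Suc j)
  then show ?case by (simp add: mbinom_pred)
qed

lemma sum_binom_poly_eq_mbinom:
  assumes "a \<le> b" "1 \<le> j"
  shows "(\<Sum>k\<in>{a..<b}. binom_poly (- k + int j - 1) (j - 1)) = mbinom j (a - 1) - mbinom j (b - 1)"
  using sum_binom_poly_telescope[OF assms(1), of "int j - 1" "j - 1"] assms(2)
  by (simp add: mbinom_def algebra_simps)

text \<open>Raising \<open>d\<close> by one changes the base value of all earlier summands on the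
  right from \<open>b (d + 1)\<close> to \<open>b (d + 2)\<close>. By \<open>mbinom_pred_sum\<close>
  the single new summand on the left expands into exactly these corrections together with the new
  summand on the right.\<close>

lemma sum_mbinom_shift:
  "(\<Sum>j = 1..d. mbinom j (b (j + 1) - 1) - mbinom j (b j - 1)) =
    (\<Sum>j = 1..d. mbinom j (b (d + 1)) - mbinom j (b j))"
proof (induction d)
  case 0
  then show ?case by simp
next
  case (Suc d)
  have split_sum: "(\<Sum>i\<le>Suc d. f i) = f 0 + (\<Sum>j = 1..d. f j) + f (Suc d)" for f :: "nat \<Rightarrow> rat poly"
    by (simp add: sum.atMost_shift sum.atLeast1_atMost_eq)
  \<comment> \<open>The terms of index 0 in the two expansions are both 1 and cancel.\<close>
  have "mbinom (Suc d) (b (d + 2) - 1) - mbinom (Suc d) (b (d + 1) - 1) =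
      (\<Sum>j = 1..d. mbinom j (b (d + 2))) + mbinom (Suc d) (b (d + 2)) -
      (\<Sum>j = 1..d. mbinom j (b (d + 1))) - mbinom (Suc d) (b (d + 1))"
    by (simp add: mbinom_pred_sum split_sum del: sum.atMost_Suc) (simp add: mbinom_def)
  then show ?case using Suc by (simp add: sum_subtractf)
qed

section \<open>Recovering the constants from coefficients\<close>

lemma degree_binom_poly: "degree (binom_poly c j) \<le> j"
  and coeff_binom_poly: "coeff (binom_poly c j) j = 1 / fact j"
proof -
  let ?p = "\<lambda>j. \<Prod>i<j. [:of_int c - of_nat i, 1 :: rat:]"
  have "degree (?p j) = j \<and> coeff (?p j) j = 1"
  proof (induction j)
    case 0
    then show ?case by simp
  next
    case (Suc j)
    then have "?p j \<noteq> 0" by (metis coeff_0 zero_neq_one)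
    then have "degree (?p (Suc j)) = Suc j"
      using Suc by (simp add: degree_mult_eq del: mult_pCons_right)
    moreover have "lead_coeff (?p (Suc j)) = 1"
      using Suc by (simp add: lead_coeff_mult del: mult_pCons_right)
    ultimately show ?case by metis
  qed
  then show "degree (binom_poly c j) \<le> j" "coeff (binom_poly c j) j = 1 / fact j"
    by (auto simp: binom_poly_def intro: order_trans[OF degree_smult_le])
qed

text \<open>Telescoping backwards, the difference is a sum of a' - a binomials of degree
  \<open>j\<close>, each with leading coefficient \<open>1 / fact j\<close>.\<close>

lemma mbinom_diff_degree_coeff_le:
  assumes "a \<le> a'"
  shows "degree (mbinom (Suc j) a - mbinom (Suc j) a') \<le> j \<and>
    coeff (mbinom (Suc j) a - mbinom (Suc j) a') j = of_int (a' - a) / fact j"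
proof -
  have eq: "mbinom (Suc j) a - mbinom (Suc j) a' = (\<Sum>k\<in>{a..<a'}. binom_poly (int j - 1 - k) j)"
    using sum_binom_poly_telescope[OF assms, of "int j - 1" j] by (simp add: mbinom_def algebra_simps)
  show ?thesis unfolding eq
    using assms
    by (auto intro!: degree_sum_le degree_binom_poly simp: coeff_sum coeff_binom_poly)
qed

lemma mbinom_diff_degree_coeff:
  "degree (mbinom (Suc j) a - mbinom (Suc j) a') \<le> j \<and>
    coeff (mbinom (Suc j) a - mbinom (Suc j) a') j = of_int (a' - a) / fact j"
proof (cases "a \<le> a'")
  case True
  then show ?thesis by (rule mbinom_diff_degree_coeff_le)
next
  case False
  then show ?thesis
    using mbinom_diff_degree_coeff_le[of a' a j] degree_minus[of "mbinom (Suc j) a' - mbinom (Suc j) a"]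
      coeff_minus[of "mbinom (Suc j) a' - mbinom (Suc j) a" j]
    by (simp add: field_simps)
qed

text \<open>The top coefficient of \<open>mbinom j a\<close> does not depend on \<open>a\<close>, so
  the coefficient one degree lower is compared. At z^n the index n + 1 contributes
  \<open>(b' (n + 1) - b (n + 1)) / fact n\<close>, and the smaller indices contribute nothing. Once
  the top constants agree, their terms cancel and the induction continues downwards.\<close>

lemma sum_mbinom_inject:
  fixes b b' :: "nat \<Rightarrow> int"
  assumes "(\<Sum>j = 1..n. mbinom j (b j)) = (\<Sum>j = 1..n. mbinom j (b' j))" "i \<in> {1..n}"
  shows "b i = b' i"
  using assms
proof (induction n arbitrary: i)
  case 0
  then show ?case by simp
next
  case (Suc n)
  let ?D = "\<lambda>j. mbinom j (b j) - mbinom j (b' j)"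
  have sum0: "(\<Sum>j = 1..n. ?D j) + ?D (Suc n) = 0"
    using Suc.prems(1) by (simp add: sum_subtractf algebra_simps)
  have "coeff (?D j) n = 0" if j: "j \<in> {1..n}" for j
  proof -
    obtain k where "j = Suc k" using j by (cases j) simp_all
    with j mbinom_diff_degree_coeff[of k "b j" "b' j"] show ?thesis
      by (intro coeff_eq_0) auto
  qed
  then have "coeff (\<Sum>j = 1..n. ?D j) n = 0" by (simp add: coeff_sum)
  then have "coeff (?D (Suc n)) n = 0" using sum0 by (metis add_0 coeff_0 coeff_add)
  then have eq: "b (Suc n) = b' (Suc n)"
    using mbinom_diff_degree_coeff[of n "b (Suc n)" "b' (Suc n)"] by simp
  show ?case
  proof (cases "i = Suc n")
    case False
    then show ?thesis using Suc eq by simp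
  qed (use eq in simp)
qed

section \<open>Uniqueness of the Hilbert polynomial\<close>

lemma poly_eqI_eventually:
  fixes p q :: "'a::{idom, ring_char_0} poly"
  assumes "\<forall>\<^sub>F j in at_top. poly p (of_int j) = poly q (of_int j)"
  shows "p = q"
proof -
  obtain N where N: "\<And>j. j \<ge> N \<Longrightarrow> poly (p - q) (of_int j) = 0"
    using assms by (auto simp: eventually_at_top_linorder)
  have "infinite ((of_int :: int \<Rightarrow> 'a) ` {N..})"
    by (simp add: finite_image_iff inj_on_def infinite_Ici)
  moreover have "of_int ` {N..} \<subseteq> {x. poly (p - q) x = 0}" using N by auto
  ultimately have "p - q = 0" using poly_roots_finite infinite_super by blast
  then show ?thesis by simp
qed

text \<open>Justifies the definite description in \<open>hilbert_poly\<close>: a polynomial is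
  determined by its values at all large integers.\<close>

lemma hilbert_poly_eqI:
  assumes "\<forall>\<^sub>F j in at_top. poly p (of_int j) = of_nat (K_dim M (Gr j))"
  shows "hilbert_poly M Gr = p"
  unfolding hilbert_poly_def
proof (rule the_equality)
  fix q :: "rat poly" assume "\<forall>\<^sub>F j in at_top. poly q (of_int j) = of_nat (K_dim M (Gr j))"
  with assms show "q = p"
    by (intro poly_eqI_eventually) (auto elim: eventually_elim2)
qed (rule assms)


section \<open>Dimensions of subspaces of a module\<close>

text \<open>Independence of an indexed family already includes injectivity of the indexing. This
  serves families such as \<open>cone_vec\<close>, whose members are not known to be distinct
  beforehand.\<close>

lemma (in vector_space) dim_eq_card_family:
  assumes "finite I" "v ` I \<subseteq> W" "W \<subseteq> span (v ` I)"
    and "\<And>a i. (\<Sum>i\<in>I. scale (a i) (v i)) = 0 \<Longrightarrow> i \<in> I \<Longrightarrow> a i = 0"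
  shows "independent (v ` I)" "card (v ` I) = card I"
proof -
  have inj: "inj_on v I"
  proof (rule inj_onI, rule ccontr)
    fix i j assume ij: "i \<in> I" "j \<in> I" "v i = v j" "i \<noteq> j"
    \<comment> \<open>A repeated vector would give the nontrivial relation
      \<open>v i - v j = 0\<close>.\<close>
    let ?a = "\<lambda>k. (if k = i then 1 else if k = j then - 1 else 0) :: 'a"
    have "(\<Sum>k\<in>I. scale (?a k) (v k)) = (\<Sum>k\<in>{i, j}. scale (?a k) (v k))"
      using ij assms(1) by (intro sum.mono_neutral_right) auto
    also have "\<dots> = 0" using ij by simp
    finally show False using assms(4)[of ?a i] ij by simp
  qed
  then show "card (v ` I) = card I" by (rule card_image)
  show "independent (v ` I)"
  proof (rule independent_if_scalars_zero)
    fix f x assume "(\<Sum>x\<in>v ` I. scale (f x) x) = 0" "x \<in> v ` I"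
    then show "f x = 0"
      using assms(4)[of "f \<circ> v"] inj by (auto simp: sum.reindex)
  qed (use assms in simp)
qed

text \<open>A bridge between two notions of dimension: \<open>V\<close> sits in the carrier of a
  module and has \<open>const c\<close> as scalars, while \<open>W\<close> is a subspace of a vector
  space on a type, where the general theory of bases applies. The map identifies the two.\<close>

locale linear_coordinates = vector_space scale
  for scale :: "'k::field \<Rightarrow> 'b::ab_group_add \<Rightarrow> 'b" +
  fixes X :: "'x set" and M :: "(('x, 'k) mpoly, 'm) module"
    and W :: "'b set" and V :: "'m set" and \<phi> :: "'b \<Rightarrow> 'm"
  assumes module: "module (poly_ring X) M"
    and subspace_W: "subspace W"
    and V_subset: "V \<subseteq> carrier M"
    and bij: "bij_betw \<phi> W V"
    and map_add: "\<And>x y. x \<in> W \<Longrightarrow> y \<in> W \<Longrightarrow> \<phi> (x + y) = \<phi> x \<oplus>\<^bsub>M\<^esub> \<phi> y"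
    and map_scale: "\<And>c x. x \<in> W \<Longrightarrow> \<phi> (scale c x) = const c \<odot>\<^bsub>M\<^esub> \<phi> x"
begin

interpretation M: module "poly_ring X" M by (rule module)

lemma map_in: "x \<in> W \<Longrightarrow> \<phi> x \<in> carrier M"
  using bij V_subset by (auto simp: bij_betw_def)

lemma map_zero: "\<phi> 0 = \<zero>\<^bsub>M\<^esub>"
proof -
  have "\<phi> 0 \<oplus>\<^bsub>M\<^esub> \<phi> 0 = \<phi> 0"
    using map_add[of 0 0] subspace_0[OF subspace_W] by simp
  then show ?thesis
    using map_in[OF subspace_0[OF subspace_W]] by (metis M.add.l_cancel_one)
qed

lemma map_sum:
  assumes "finite T" "T \<subseteq> W"
  shows "\<phi> (\<Sum>u\<in>T. scale (a u) u) = finsum M (\<lambda>u. const (a u) \<odot>\<^bsub>M\<^esub> \<phi> u) T"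
  using assms
proof (induction T)
  case empty
  then show ?case by (simp add: map_zero)
next
  case (insert u T)
  have S: "scale (a u) u \<in> W" if "u \<in> W" for u
    using that subspace_scale[OF subspace_W] by blast
  have closed: "const (a u) \<odot>\<^bsub>M\<^esub> \<phi> u \<in> carrier M" if "u \<in> W" for u
    using map_in[OF S[OF that]] map_scale[OF that] by simp
  have "(\<Sum>u\<in>T. scale (a u) u) \<in> W"
    using insert.prems S by (intro subspace_sum[OF subspace_W]) auto
  then have "\<phi> (\<Sum>u\<in>insert u T. scale (a u) u) =
      const (a u) \<odot>\<^bsub>M\<^esub> \<phi> u \<oplus>\<^bsub>M\<^esub> finsum M (\<lambda>u. const (a u) \<odot>\<^bsub>M\<^esub> \<phi> u) T"
    using insert S by (simp add: map_add map_scale)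
  also have "\<dots> = finsum M (\<lambda>u. const (a u) \<odot>\<^bsub>M\<^esub> \<phi> u) (insert u T)"
    using insert closed by (intro M.finsum_insert[symmetric]) auto
  finally show ?case .
qed

text \<open>In \<open>is_K_basis\<close> the existence of coefficients corresponds to spanning, and
  their uniqueness for the vector 0 already corresponds to independence. The coefficient functions
  are extensional on the image of \<open>T\<close>, hence the restrictions in the proof.\<close>

lemma is_K_basis_image_iff:
  assumes "finite T" "T \<subseteq> W"
  shows "is_K_basis M V (\<phi> ` T) \<longleftrightarrow> independent T \<and> W \<subseteq> span T"
proof -
  have injW: "inj_on \<phi> W" and imW: "\<phi> ` W = V" using bij by (auto simp: bij_betw_def)
  then have inj: "inj_on \<phi> T" using assms inj_on_subset by blast
  have comb: "finsum M (\<lambda>v. const (c v) \<odot>\<^bsub>M\<^esub> v) (\<phi> ` T) = \<phi> (\<Sum>u\<in>T. scale (c (\<phi> u)) u)" for c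
  proof -
    have "(\<lambda>v. const (c v) \<odot>\<^bsub>M\<^esub> v) \<in> \<phi> ` T \<rightarrow> carrier M"
    proof
      fix v assume "v \<in> \<phi> ` T"
      then obtain u where u: "u \<in> W" "v = \<phi> u" using assms by auto
      then show "const (c v) \<odot>\<^bsub>M\<^esub> v \<in> carrier M"
        using map_scale[of u "c v"] map_in[OF subspace_scale[OF subspace_W]] by metis
    qed
    then show ?thesis using map_sum[OF assms, of "c \<circ> \<phi>"] inj by (simp add: M.finsum_reindex)
  qed
  have inW: "(\<Sum>u\<in>T. scale (a u) u) \<in> W" for a
    using assms by (intro subspace_sum[OF subspace_W] subspace_scale[OF subspace_W]) auto
  have eq_iff: "\<phi> w = \<phi> (\<Sum>u\<in>T. scale (a u) u) \<longleftrightarrow> w = (\<Sum>u\<in>T. scale (a u) u)" if "w \<in> W" for w a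
    using injW inW that by (auto simp: inj_on_def)
  have basis_iff: "is_K_basis M V (\<phi> ` T) \<longleftrightarrow>
    (\<forall>w\<in>W. \<exists>!c. c \<in> \<phi> ` T \<rightarrow>\<^sub>E UNIV \<and> w = (\<Sum>u\<in>T. scale (c (\<phi> u)) u))"
  proof -
    have "is_K_basis M V (\<phi> ` T) \<longleftrightarrow>
        (\<forall>w\<in>W. \<exists>!c. c \<in> \<phi> ` T \<rightarrow>\<^sub>E UNIV \<and> \<phi> w = \<phi> (\<Sum>u\<in>T. scale (c (\<phi> u)) u))"
      unfolding is_K_basis_def comb imW[symmetric] ball_simps(9) using assms by blast
    then show ?thesis by (simp only: eq_iff cong: ball_cong)
  qed
  show ?thesis
  proof
    assume "is_K_basis M V (\<phi> ` T)"
    then have uniq: "\<exists>!c. c \<in> \<phi> ` T \<rightarrow>\<^sub>E UNIV \<and> w = (\<Sum>u\<in>T. scale (c (\<phi> u)) u)" if "w \<in> W" for w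
      using that basis_iff by blast
    have "independent T"
    proof (rule independent_if_scalars_zero[OF assms(1)])
      fix f x assume f: "(\<Sum>u\<in>T. scale (f u) u) = 0" and x: "x \<in> T"
      \<comment> \<open>Two coefficient functions representing 0: the given relation carried over to
        the image, and the zero function.\<close>
      let ?c = "restrict (f \<circ> inv_into T \<phi>) (\<phi> ` T)" and ?z = "restrict (\<lambda>_. 0) (\<phi> ` T)"
      have eqI: "c = c'" if "c \<in> \<phi> ` T \<rightarrow>\<^sub>E UNIV" "c' \<in> \<phi> ` T \<rightarrow>\<^sub>E UNIV"
        "0 = (\<Sum>u\<in>T. scale (c (\<phi> u)) u)" "0 = (\<Sum>u\<in>T. scale (c' (\<phi> u)) u)" for c c'
        using that uniq[OF subspace_0[OF subspace_W]] by blast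
      have "?c = ?z" by (rule eqI) (use f inj in simp_all)
      then have "?c (\<phi> x) = ?z (\<phi> x)" by simp
      then show "f x = 0" using x inj by simp
    qed
    moreover have "W \<subseteq> span T"
    proof
      fix w assume "w \<in> W"
      then obtain c where "w = (\<Sum>u\<in>T. scale (c (\<phi> u)) u)" using uniq by blast
      then show "w \<in> span T" by (simp add: span_sum span_scale span_base)
    qed
    ultimately show "independent T \<and> W \<subseteq> span T" by blast
  next
    assume *: "independent T \<and> W \<subseteq> span T"
    then have ind: "a u = 0" if "(\<Sum>u\<in>T. scale (a u) u) = 0" "u \<in> T" for a u
      using that dependent_finite[OF assms(1)] by auto
    show "is_K_basis M V (\<phi> ` T)" unfolding basis_iff
    proof
      fix w assume "w \<in> W"
      then obtain a where a: "w = (\<Sum>u\<in>T. scale (a u) u)"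
        using * span_finite[OF assms(1)] by auto
      show "\<exists>!c. c \<in> \<phi> ` T \<rightarrow>\<^sub>E UNIV \<and> w = (\<Sum>u\<in>T. scale (c (\<phi> u)) u)"
      proof (rule ex1I)
        show "restrict (a \<circ> inv_into T \<phi>) (\<phi> ` T) \<in> \<phi> ` T \<rightarrow>\<^sub>E UNIV \<and>
          w = (\<Sum>u\<in>T. scale (restrict (a \<circ> inv_into T \<phi>) (\<phi> ` T) (\<phi> u)) u)"
          using a inj by simp
      next
        fix c assume c: "c \<in> \<phi> ` T \<rightarrow>\<^sub>E UNIV \<and> w = (\<Sum>u\<in>T. scale (c (\<phi> u)) u)"
        then have "(\<Sum>u\<in>T. scale (c (\<phi> u) - a u) u) = 0"
          using a by (simp add: scale_left_diff_distrib sum_subtractf)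
        then have "\<forall>u\<in>T. c (\<phi> u) - a u = 0"
          using ind[of "\<lambda>u. c (\<phi> u) - a u"] by blast
        then show "c = restrict (a \<circ> inv_into T \<phi>) (\<phi> ` T)"
          using c inj by (intro PiE_ext[of c "\<phi> ` T" "\<lambda>_. UNIV"]) auto
      qed
    qed
  qed
qed

text \<open>The definite description in \<open>K_dim\<close> is legitimate because every basis of
  \<open>V\<close> is the image of a basis of \<open>W\<close>, and all bases of \<open>W\<close>
  have \<open>dim W\<close> elements.\<close>

lemma K_dim_eq_card:
  assumes "finite T" "T \<subseteq> W" "independent T" "W \<subseteq> span T"
  shows "K_dim M V = card T"
  unfolding K_dim_def
proof (rule the_equality)
  have "inj_on \<phi> T" using bij assms(2) inj_on_subset by (auto simp: bij_betw_def)
  then show "\<exists>B. is_K_basis M V B \<and> card B = card T"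
    using is_K_basis_image_iff[OF assms(1,2)] assms card_image by blast
next
  fix n assume "\<exists>B. is_K_basis M V B \<and> card B = n"
  then obtain B where B: "is_K_basis M V B" "card B = n" by blast
  then have fin: "finite B" and "B \<subseteq> \<phi> ` W"
    using bij by (auto simp: is_K_basis_def bij_betw_def)
  then obtain T' where T': "T' \<subseteq> W" "inj_on \<phi> T'" "B = \<phi> ` T'"
    using subset_image_inj by metis
  then have "finite T'" using fin finite_imageD by blast
  then have "independent T'" "W \<subseteq> span T'" using B T' is_K_basis_image_iff by blast+
  then have "card T' = dim W" using T' basis_card_eq_dim by blast
  moreover have "card T = dim W" using assms basis_card_eq_dim by blast
  ultimately show "n = card T" using T' B card_image by metis
qed

end


section \<open>Coefficients and supports\<close>

lemma poly_mapping_eq_sum_single: "p = (\<Sum>\<alpha>\<in>keys p. Poly_Mapping.single \<alpha> (lookup p \<alpha>))"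
  by (rule poly_mapping_eqI) (simp add: lookup_sum lookup_single when_def in_keys_iff)

lemma lookup_single_mult_add:
  fixes q :: "'a::cancel_comm_monoid_add \<Rightarrow>\<^sub>0 'k::semiring_0"
  shows "lookup (Poly_Mapping.single \<beta> c * q) (\<beta> + \<alpha>) = c * lookup q \<alpha>"
  by (simp add: lookup_mult lookup_single when_mult)

lemma lookup_single_mult_nonzeroD:
  assumes "lookup (Poly_Mapping.single \<beta> c * q) \<gamma> \<noteq> 0"
  shows "\<exists>\<alpha>\<in>keys q. \<gamma> = \<beta> + \<alpha>"
proof -
  have "\<gamma> \<in> keys (Poly_Mapping.single \<beta> c * q)" using assms by (simp add: in_keys_iff)
  then show ?thesis using keys_mult[of "Poly_Mapping.single \<beta> c" q] by (auto split: if_splits)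
qed

text \<open>If an exponent arises in only one way as a sum of exponents from the two factors, no
  cancellation can occur there. For leading exponents this shows that a product is nonzero.\<close>

lemma lookup_mult_unique_decomposition:
  fixes p q :: "'a::cancel_comm_monoid_add \<Rightarrow>\<^sub>0 'k::semiring_0"
  assumes "\<And>\<alpha> \<beta>. \<alpha> \<in> keys p \<Longrightarrow> \<beta> \<in> keys q \<Longrightarrow> \<alpha> + \<beta> = \<alpha>0 + \<beta>0 \<Longrightarrow> \<alpha> = \<alpha>0"
    and "\<alpha>0 \<in> keys p"
  shows "lookup (p * q) (\<alpha>0 + \<beta>0) = lookup p \<alpha>0 * lookup q \<beta>0"
proof -
  let ?s = "\<lambda>\<alpha>. Poly_Mapping.single \<alpha> (lookup p \<alpha>)"
  have "p * q = (\<Sum>\<alpha>\<in>keys p. ?s \<alpha> * q)"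
    by (subst poly_mapping_eq_sum_single[of p]) (rule sum_distrib_right)
  then have "lookup (p * q) (\<alpha>0 + \<beta>0) = (\<Sum>\<alpha>\<in>keys p. lookup (?s \<alpha> * q) (\<alpha>0 + \<beta>0))"
    by (simp add: lookup_sum)
  also have "\<dots> = (\<Sum>\<alpha>\<in>{\<alpha>0}. lookup (?s \<alpha> * q) (\<alpha>0 + \<beta>0))"
  proof (intro sum.mono_neutral_right ballI)
    fix \<alpha> assume \<alpha>: "\<alpha> \<in> keys p - {\<alpha>0}"
    show "lookup (?s \<alpha> * q) (\<alpha>0 + \<beta>0) = 0"
    proof (rule ccontr)
      assume "lookup (?s \<alpha> * q) (\<alpha>0 + \<beta>0) \<noteq> 0"
      from lookup_single_mult_nonzeroD[OF this] obtain \<beta> where "\<beta> \<in> keys q" "\<alpha> + \<beta> = \<alpha>0 + \<beta>0"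
        by auto
      with assms(1) \<alpha> show False by blast
    qed
  qed (use assms(2) in simp_all)
  finally show ?thesis by (simp add: lookup_single_mult_add)
qed

section \<open>Counting monomials of a given degree\<close>

lemma mdeg_add: "mdeg (\<alpha> + \<beta>) = mdeg \<alpha> + mdeg \<beta>"
proof -
  have "mdeg \<gamma> = (\<Sum>x\<in>keys \<alpha> \<union> keys \<beta>. lookup \<gamma> x)" if "keys \<gamma> \<subseteq> keys \<alpha> \<union> keys \<beta>" for \<gamma>
    unfolding mdeg_def using that by (intro sum.mono_neutral_left) (auto simp: in_keys_iff)
  then show ?thesis using keys_add[of \<alpha> \<beta>] by (simp add: lookup_add sum.distrib)
qed

definition exponents :: "'x set \<Rightarrow> nat \<Rightarrow> ('x \<Rightarrow>\<^sub>0 nat) set" where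
  "exponents U n = {\<alpha>. keys \<alpha> \<subseteq> U \<and> mdeg \<alpha> = n}"

text \<open>An exponent function is a finite multiset of variables and \<open>mdeg\<close> is its
  size, so counting monomials becomes counting multisets.\<close>

lemma bij_betw_multisets_exponents:
  fixes U :: "'x set"
  shows "bij_betw (\<lambda>A. Abs_poly_mapping (count A)) (multisets_of_size U n) (exponents U n)"
proof (rule bij_betw_byWitness[where f' = "\<lambda>\<alpha>. Abs_multiset (lookup \<alpha>)"])
  have lookup: "lookup (Abs_poly_mapping (count A)) = count A" for A :: "'x multiset"
  proof (rule lookup_Abs_poly_mapping)
    have "{x. count A x \<noteq> 0} = set_mset A" by (simp add: set_eq_iff count_eq_zero_iff)
    then show "finite {x. count A x \<noteq> 0}" by simp
  qed
  have count: "count (Abs_multiset (lookup \<alpha>)) = lookup \<alpha>" for \<alpha> :: "'x \<Rightarrow>\<^sub>0 nat"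
    by (rule count_Abs_multiset) (use finite_lookup[of \<alpha>] in simp)
  have keys: "keys (Abs_poly_mapping (count A)) = set_mset A" for A :: "'x multiset"
    by (auto simp: in_keys_iff lookup)
  show "\<forall>A\<in>multisets_of_size U n. Abs_multiset (lookup (Abs_poly_mapping (count A))) = A"
    by (simp add: lookup)
  show "\<forall>\<alpha>\<in>exponents U n. Abs_poly_mapping (count (Abs_multiset (lookup \<alpha>))) = \<alpha>"
    by (simp add: count)
  show "(\<lambda>A. Abs_poly_mapping (count A)) ` multisets_of_size U n \<subseteq> exponents U n"
    by (auto simp: exponents_def multisets_of_size_def mdeg_def keys lookup size_multiset_overloaded_eq)
  have "set_mset (Abs_multiset (lookup \<alpha>)) = keys \<alpha>" for \<alpha> :: "'x \<Rightarrow>\<^sub>0 nat"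
    by (auto simp: in_keys_iff count simp flip: count_greater_zero_iff)
  then show "(\<lambda>\<alpha>. Abs_multiset (lookup \<alpha>)) ` exponents U n \<subseteq> multisets_of_size U n"
    by (auto simp: exponents_def multisets_of_size_def mdeg_def count size_multiset_overloaded_eq)
qed

text \<open>The truncated subtraction is harmless for \<open>U = {}\<close>: the value is 1 for
  \<open>n = 0\<close> and 0 for positive \<open>n\<close>.\<close>

lemma card_exponents: "finite U \<Longrightarrow> card (exponents U n) = (card U + n - 1) choose n"
  using bij_betw_same_card[OF bij_betw_multisets_exponents] card_multisets_of_size by metis

lemma finite_exponents: "finite U \<Longrightarrow> finite (exponents U n)"
  using bij_betw_finite[OF bij_betw_multisets_exponents] finite_multisets_of_size by metis

section \<open>Vectors of the free module as functions on monomials\<close>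

definition fcoeff :: "('x, 'k::field, 'm) fvec \<Rightarrow> 'm \<times> ('x \<Rightarrow>\<^sub>0 nat) \<Rightarrow> 'k" where
  "fcoeff f u = lookup (lookup f (fst u)) (snd u)"

lemma fvec_eqI: "(\<And>u. fcoeff f u = fcoeff f' u) \<Longrightarrow> f = f'"
  by (intro poly_mapping_eqI) (force simp: fcoeff_def)

lemma supp_iff: "u \<in> supp f \<longleftrightarrow> fcoeff f u \<noteq> 0"
  by (cases u) (simp add: supp_def fcoeff_def)

lemma fcoeff_zero [simp]: "fcoeff 0 u = 0"
  and fcoeff_add: "fcoeff (f + f') u = fcoeff f u + fcoeff f' u"
  and fcoeff_uminus: "fcoeff (- f) u = - fcoeff f u"
  and fcoeff_sum: "fcoeff (\<Sum>i\<in>I. h i) u = (\<Sum>i\<in>I. fcoeff (h i) u)"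
  by (simp_all add: fcoeff_def lookup_add lookup_minus lookup_sum)

lemma finite_supp: "finite (supp f)"
proof (rule finite_subset)
  show "supp f \<subseteq> (SIGMA g:keys f. keys (lookup f g))"
    by (auto simp: supp_def in_keys_iff)
qed simp

lemma supp_empty_iff: "supp f = {} \<longleftrightarrow> f = 0"
proof
  assume "supp f = {}"
  then show "f = 0" by (intro fvec_eqI) (metis empty_iff fcoeff_zero supp_iff)
qed (simp add: supp_def)

lemma lookup_fscale: "lookup (fscale p f) g = p * lookup f g"
  by (simp add: fscale_def map.rep_eq when_def)

lemma fscale_simps:
  "fscale p (f + f') = fscale p f + fscale p f'"
  "fscale (p + p') f = fscale p f + fscale p' f"
  "fscale (p * p') f = fscale p (fscale p' f)"
  "fscale 1 f = f" "fscale 0 f = 0" "fscale p 0 = 0"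
  by (rule poly_mapping_eqI; simp add: lookup_fscale lookup_add algebra_simps)+

lemma fscale_sum: "fscale (\<Sum>i\<in>I. p i) f = (\<Sum>i\<in>I. fscale (p i) f)"
  by (induction I rule: infinite_finite_induct) (simp_all add: fscale_simps)

lemma supp_fscale: "supp (fscale p f) \<subseteq> {(g, \<alpha> + \<beta>) | g \<alpha> \<beta>. \<alpha> \<in> keys p \<and> (g, \<beta>) \<in> supp f}"
proof
  fix u assume u: "u \<in> supp (fscale p f)"
  then have "snd u \<in> keys (p * lookup f (fst u))"
    by (simp add: supp_iff fcoeff_def lookup_fscale in_keys_iff)
  then obtain \<alpha> \<beta> where "\<alpha> \<in> keys p" "\<beta> \<in> keys (lookup f (fst u))" "snd u = \<alpha> + \<beta>"
    using keys_mult by blast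
  then show "u \<in> {(g, \<alpha> + \<beta>) | g \<alpha> \<beta>. \<alpha> \<in> keys p \<and> (g, \<beta>) \<in> supp f}"
    by (cases u) (auto simp: supp_iff fcoeff_def in_keys_iff)
qed

definition kscale :: "'k::field \<Rightarrow> ('x, 'k, 'm) fvec \<Rightarrow> ('x, 'k, 'm) fvec" where
  "kscale c f = fscale (const c) f"

lemma fcoeff_kscale: "fcoeff (kscale c f) u = c * fcoeff f u"
  using lookup_single_mult_add[of 0 c "lookup f (fst u)" "snd u"]
  by (simp add: kscale_def const_def fcoeff_def lookup_fscale)

text \<open>The vector space is the whole type. \<open>F\<close>, the kernel, the normal space and
  the degree components will be subspaces of it.\<close>

interpretation fvec: vector_space kscale
  by unfold_locales (rule fvec_eqI; simp add: fcoeff_kscale fcoeff_add algebra_simps)+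

lemma fcoeff_monom_vec: "fcoeff (monom_vec u) v = (if u = v then 1 else 0)"
  by (auto simp: fcoeff_def monom_vec_def lookup_single when_def prod_eq_iff)

lemma supp_monom_vec [simp]: "supp (monom_vec u :: ('x, 'k::field, 'm) fvec) = {u}"
  by (auto simp: supp_iff fcoeff_monom_vec split: if_splits)

lemma fvec_eq_sum_monom_vec: "f = (\<Sum>u\<in>supp f. kscale (fcoeff f u) (monom_vec u))"
  by (rule fvec_eqI)
    (simp add: fcoeff_sum fcoeff_kscale fcoeff_monom_vec if_distrib finite_supp supp_iff cong: if_cong)

text \<open>The linear projection onto the span of the monomials in \<open>A\<close>. Homogeneous
  components are obtained by taking for \<open>A\<close> the monomials of one degree.\<close>

definition frestrict :: "('m \<times> ('x \<Rightarrow>\<^sub>0 nat)) set \<Rightarrow> ('x, 'k::field, 'm) fvec \<Rightarrow> ('x, 'k, 'm) fvec" where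
  "frestrict A f = Poly_Mapping.mapp (\<lambda>g. Poly_Mapping.mapp (\<lambda>\<alpha> c. if (g, \<alpha>) \<in> A then c else 0)) f"

lemma fcoeff_frestrict: "fcoeff (frestrict A f) u = (if u \<in> A then fcoeff f u else 0)"
  by (cases u) (auto simp: fcoeff_def frestrict_def lookup_mapp when_def in_keys_iff)

lemma supp_frestrict: "supp (frestrict A f) = supp f \<inter> A"
  by (auto simp: supp_iff fcoeff_frestrict split: if_splits)

lemma frestrict_linear:
  "frestrict A (f + f') = frestrict A f + frestrict A f'"
  "frestrict A (kscale c f) = kscale c (frestrict A f)"
  "frestrict A (\<Sum>i\<in>I. h i) = (\<Sum>i\<in>I. frestrict A (h i))"
  by (rule fvec_eqI; simp add: fcoeff_frestrict fcoeff_add fcoeff_kscale fcoeff_sum)+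

lemma frestrict_cases:
  "supp f \<subseteq> A \<Longrightarrow> frestrict A f = f"
  "supp f \<inter> A = {} \<Longrightarrow> frestrict A f = 0"
  by (rule fvec_eqI; auto simp: fcoeff_frestrict supp_iff)+

definition xmult :: "('x \<Rightarrow>\<^sub>0 nat) \<Rightarrow> ('x, 'k::field, 'm) fvec \<Rightarrow> ('x, 'k, 'm) fvec" where
  "xmult \<beta> f = fscale (Poly_Mapping.single \<beta> 1) f"

lemma fcoeff_xmult: "fcoeff (xmult \<beta> f) (g, \<beta> + \<alpha>) = fcoeff f (g, \<alpha>)"
  by (simp add: fcoeff_def xmult_def lookup_fscale lookup_single_mult_add)

lemma supp_xmult: "supp (xmult \<beta> f) = (\<lambda>(g, \<alpha>). (g, \<beta> + \<alpha>)) ` supp f"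
proof
  show "supp (xmult \<beta> f) \<subseteq> (\<lambda>(g, \<alpha>). (g, \<beta> + \<alpha>)) ` supp f"
    using supp_fscale[of "Poly_Mapping.single \<beta> 1" f] by (auto simp: xmult_def)
  show "(\<lambda>(g, \<alpha>). (g, \<beta> + \<alpha>)) ` supp f \<subseteq> supp (xmult \<beta> f)"
    by (auto simp: supp_iff fcoeff_xmult)
qed

lemma fscale_single: "fscale (Poly_Mapping.single \<beta> c) f = kscale c (xmult \<beta> f)"
  by (simp add: kscale_def xmult_def const_def mult_single flip: fscale_simps(3))

lemma fscale_eq_sum: "fscale p f = (\<Sum>\<beta>\<in>keys p. kscale (lookup p \<beta>) (xmult \<beta> f))"
  by (subst poly_mapping_eq_sum_single[of p]) (simp add: fscale_sum fscale_single)

lemma carrier_poly_ring_iff: "p \<in> carrier (poly_ring X) \<longleftrightarrow> (\<forall>\<alpha>\<in>keys p. keys \<alpha> \<subseteq> X)"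
  by (simp add: poly_ring_def)

lemma single_in_poly_ring: "keys \<alpha> \<subseteq> X \<Longrightarrow> Poly_Mapping.single \<alpha> c \<in> carrier (poly_ring X)"
  by (simp add: carrier_poly_ring_iff)

lemma const_in_poly_ring: "const c \<in> carrier (poly_ring X)"
  by (simp add: const_def single_in_poly_ring)

lemma carrier_free_module_iff: "f \<in> carrier (free_module X G) \<longleftrightarrow> supp f \<subseteq> monomials X G"
proof -
  have "keys f \<subseteq> G" if "supp f \<subseteq> monomials X G"
  proof
    fix g assume "g \<in> keys f"
    then obtain \<alpha> where "lookup (lookup f g) \<alpha> \<noteq> 0"
      by (metis in_keys_iff lookup_zero poly_mapping_eqI)
    then show "g \<in> G" using that by (auto simp: supp_def monomials_def)
  qed
  moreover have "f \<in> carrier (free_module X G) \<longleftrightarrow>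
      keys f \<subseteq> G \<and> (\<forall>g \<alpha>. (g, \<alpha>) \<in> supp f \<longrightarrow> keys \<alpha> \<subseteq> X)"
    by (simp add: free_module_def carrier_poly_ring_iff supp_def Ball_def lookup_not_eq_zero_eq_in_keys)
  moreover have "g \<in> keys f" if "(g, \<alpha>) \<in> supp f" for g \<alpha>
    using that by (auto simp: supp_def in_keys_iff)
  moreover have "supp f \<subseteq> monomials X G \<longleftrightarrow> (\<forall>g \<alpha>. (g, \<alpha>) \<in> supp f \<longrightarrow> g \<in> G \<and> keys \<alpha> \<subseteq> X)"
    by (simp add: monomials_def subset_iff)
  ultimately show ?thesis by blast
qed

lemma supp_add: "supp (f + f') \<subseteq> supp f \<union> supp f'"
  and supp_kscale: "supp (kscale c f) \<subseteq> supp f"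
  and supp_zero [simp]: "supp 0 = {}"
  by (auto simp: supp_iff fcoeff_add fcoeff_kscale)

lemma subspace_supp: "fvec.subspace {f. supp f \<subseteq> A}"
  using supp_add supp_kscale by (auto simp: fvec.subspace_def) blast+

lemma fscale_in_free_module:
  assumes "p \<in> carrier (poly_ring X)" "f \<in> carrier (free_module X G)"
  shows "fscale p f \<in> carrier (free_module X G)"
proof -
  have "u \<in> monomials X G" if u: "u \<in> supp (fscale p f)" for u
  proof -
    obtain g \<alpha> \<beta> where u: "u = (g, \<alpha> + \<beta>)" "\<alpha> \<in> keys p" "(g, \<beta>) \<in> supp f"
      using subsetD[OF supp_fscale u] by blast
    then have "keys \<alpha> \<subseteq> X" "g \<in> G" "keys \<beta> \<subseteq> X"
      using assms by (auto simp: carrier_poly_ring_iff carrier_free_module_iff monomials_def)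
    then show ?thesis using u keys_add[of \<alpha> \<beta>] by (auto simp: monomials_def)
  qed
  then show ?thesis by (auto simp: carrier_free_module_iff)
qed


section \<open>The minimal epimorphism\<close>

lemma poly_ring_simps:
  "p \<otimes>\<^bsub>poly_ring X\<^esub> q = p * q" "p \<oplus>\<^bsub>poly_ring X\<^esub> q = p + q"
  "\<zero>\<^bsub>poly_ring X\<^esub> = 0" "\<one>\<^bsub>poly_ring X\<^esub> = 1"
  by (simp_all add: poly_ring_def)

lemma generated_submodule_subset:
  "submodule N R M \<Longrightarrow> B \<subseteq> N \<Longrightarrow> generated_submodule R M B \<subseteq> N"
  by (auto simp: generated_submodule_def)

text \<open>Closure under negation comes for free, since negation is scaling by the constant
  -1.\<close>

lemma submodule_free_module:
  fixes X :: "'x set" and N :: "('x, 'k::field, 'm) fvec set"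
  assumes "N \<subseteq> carrier (free_module X G)" "0 \<in> N" "\<And>f f'. f \<in> N \<Longrightarrow> f' \<in> N \<Longrightarrow> f + f' \<in> N"
    and "\<And>p f. p \<in> carrier (poly_ring X) \<Longrightarrow> f \<in> N \<Longrightarrow> fscale p f \<in> N"
  shows "submodule N (poly_ring X) (free_module X G)"
proof (intro submodule.intro subgroup.intro submodule_axioms.intro)
  let ?F = "add_monoid (free_module X G)"
  fix f assume f: "f \<in> N"
  have neg: "- f' = fscale (const (- 1)) f'" for f' :: "('x, 'k, 'm) fvec"
    by (rule fvec_eqI) (simp add: fcoeff_kscale fcoeff_uminus flip: kscale_def)
  have "- f \<in> N" unfolding neg using f assms(4) const_in_poly_ring by blast
  \<comment> \<open>The inverse in the additive monoid of the record is a definite description, so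
    it is identified by its characteristic property.\<close>
  moreover have "inv\<^bsub>?F\<^esub> f = - f"
    unfolding m_inv_def
  proof (rule the_equality)
    show "- f \<in> carrier ?F \<and> f \<otimes>\<^bsub>?F\<^esub> - f = \<one>\<^bsub>?F\<^esub> \<and> - f \<otimes>\<^bsub>?F\<^esub> f = \<one>\<^bsub>?F\<^esub>"
      using subsetD[OF assms(1) \<open>- f \<in> N\<close>] by (simp add: free_module_def)
    show "f' = - f" if "f' \<in> carrier ?F \<and> f \<otimes>\<^bsub>?F\<^esub> f' = \<one>\<^bsub>?F\<^esub> \<and> f' \<otimes>\<^bsub>?F\<^esub> f = \<one>\<^bsub>?F\<^esub>" for f'
      using that by (simp add: free_module_def eq_neg_iff_add_eq_0)
  qed
  ultimately show "inv\<^bsub>?F\<^esub> f \<in> N" by simp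
qed (use assms in \<open>auto simp: free_module_def\<close>)

sublocale graded_module \<subseteq> M: module "poly_ring X" M
  by (rule module)

section \<open>Homogeneous components in \<open>M\<close>\<close>

context graded_module
begin

lemma Gr_subset: "Gr a \<subseteq> carrier M"
  using additive_subgroup.a_subset[OF comp_subgroup] .

lemma Gr_zero: "\<zero>\<^bsub>M\<^esub> \<in> Gr a"
  using additive_subgroup.zero_closed[OF comp_subgroup] .

lemma Gr_add: "m \<in> Gr a \<Longrightarrow> m' \<in> Gr a \<Longrightarrow> m \<oplus>\<^bsub>M\<^esub> m' \<in> Gr a"
  using additive_subgroup.a_closed[OF comp_subgroup] .

lemma smult_zero_left: "m \<in> carrier M \<Longrightarrow> 0 \<odot>\<^bsub>M\<^esub> m = \<zero>\<^bsub>M\<^esub>"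
  using M.smult_l_null by (simp add: poly_ring_simps)

lemma Gr_finsum: "finite I \<Longrightarrow> (\<And>i. i \<in> I \<Longrightarrow> h i \<in> Gr a) \<Longrightarrow> finsum M h I \<in> Gr a"
proof (induction I rule: finite_induct)
  case empty
  then show ?case by (simp add: Gr_zero)
next
  case (insert i I)
  then have "h \<in> I \<rightarrow> carrier M" "h i \<in> carrier M" using Gr_subset by blast+
  with insert show ?case by (simp add: Gr_add)
qed

text \<open>Both \<open>h\<close>, extended by zero outside \<open>D\<close>, and the function
  concentrated at \<open>c\<close> are homogeneous decompositions of the same element, so
  \<open>direct_sum\<close> forces them to coincide.\<close>

lemma components_unique:
  assumes "finite D" "\<And>a. h a \<in> Gr a" "finsum M h D \<in> Gr c" "c \<in> D" "a \<in> D"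
  shows "h a = (if a = c then finsum M h D else \<zero>\<^bsub>M\<^esub>)"
proof -
  let ?m = "finsum M h D"
  let ?h = "\<lambda>a. if a \<in> D then h a else \<zero>\<^bsub>M\<^esub>" and ?k = "\<lambda>a. if a = c then ?m else \<zero>\<^bsub>M\<^esub>"
  have closed: "h a \<in> carrier M" for a using assms(2) Gr_subset by blast
  have m: "?m \<in> carrier M" using assms(3) Gr_subset by blast
  have "{a. ?h a \<noteq> \<zero>\<^bsub>M\<^esub>} \<subseteq> D" by auto
  then have fin: "finite {a. ?h a \<noteq> \<zero>\<^bsub>M\<^esub>}" using assms(1) finite_subset by blast
  have h: "?m = finsum M ?h {a. ?h a \<noteq> \<zero>\<^bsub>M\<^esub>}"
    using assms(1) closed by (intro M.add.finprod_mono_neutral_cong_right) (auto split: if_splits)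
  have "finsum M ?k {a. ?k a \<noteq> \<zero>\<^bsub>M\<^esub>} = finsum M ?k {c}"
    using m by (intro M.add.finprod_mono_neutral_cong_left) (auto split: if_splits)
  then have k: "?m = finsum M ?k {a. ?k a \<noteq> \<zero>\<^bsub>M\<^esub>}" using m by simp
  have "finite {a. ?k a \<noteq> \<zero>\<^bsub>M\<^esub>}" by (rule finite_subset[of _ "{c}"]) auto
  then have fin_k: "finite {a. ?k a \<noteq> \<zero>\<^bsub>M\<^esub>}" .
  define P where "P f \<longleftrightarrow> (\<forall>a. f a \<in> Gr a) \<and> finite {a. f a \<noteq> \<zero>\<^bsub>M\<^esub>} \<and>
    ?m = finsum M f {a. f a \<noteq> \<zero>\<^bsub>M\<^esub>}" for f
  have "\<exists>!f. P f" unfolding P_def by (rule direct_sum[OF m])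
  moreover have "P ?h" unfolding P_def using assms(2) Gr_zero fin h by simp
  moreover have "P ?k" unfolding P_def using assms(3) Gr_zero fin_k k by simp
  ultimately have "?h = ?k" by blast
  from fun_cong[OF this, of a] show ?thesis using assms by simp
qed

text \<open>Place \<open>m\<close> in degree \<open>a\<close> and zero in degree \<open>c\<close>.
  Since the sum \<open>m\<close> also lies in \<open>Gr c\<close>, its part in degree
  \<open>a\<close> would have to vanish.\<close>

lemma Gr_disjoint:
  assumes "m \<in> Gr a" "m \<in> Gr c" "m \<noteq> \<zero>\<^bsub>M\<^esub>"
  shows "a = c"
proof (rule ccontr)
  assume "a \<noteq> c"
  let ?h = "\<lambda>x. if x = a then m else \<zero>\<^bsub>M\<^esub>"
  have "m \<in> carrier M" using assms(1) Gr_subset by blast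
  then have "finsum M ?h {a, c} = m" using \<open>a \<noteq> c\<close> by simp
  moreover have "?h x \<in> Gr x" for x using assms(1) Gr_zero by simp
  ultimately have "?h a = \<zero>\<^bsub>M\<^esub>"
    using components_unique[of "{a, c}" ?h c a] assms(2) \<open>a \<noteq> c\<close> by simp
  then show False using assms(3) by simp
qed

lemma hdeg_in:
  assumes "m \<in> (\<Union>a. Gr a)" "m \<noteq> \<zero>\<^bsub>M\<^esub>"
  shows "m \<in> Gr (hdeg Gr m)"
proof -
  obtain a where "m \<in> Gr a" using assms(1) by blast
  then have "hdeg Gr m = a"
    unfolding hdeg_def using Gr_disjoint assms(2) by (intro the_equality) blast+
  with \<open>m \<in> Gr a\<close> show ?thesis by simp
qed

end

locale macaulay_setup = graded_module X M Gr
  for X :: "'x set" and M :: "(('x, 'k::field) mpoly, 'm) module" and Gr :: "int \<Rightarrow> 'm set" +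
  fixes G :: "'m set" and r :: "(('m \<times> ('x \<Rightarrow>\<^sub>0 nat)) \<times> ('m \<times> ('x \<Rightarrow>\<^sub>0 nat))) set"
  assumes min_gens: "minimal_hom_gens X M Gr G" and order: "monomial_order X G r"
begin

abbreviation F :: "('x, 'k, 'm) fvec set" where
  "F \<equiv> carrier (free_module X G)"

abbreviation Q :: "('x, 'k, 'm) fvec set" where
  "Q \<equiv> epi_kernel X M G"

abbreviation \<phi> :: "('x, 'k, 'm) fvec \<Rightarrow> 'm" where
  "\<phi> \<equiv> min_epi M G"

definition mondeg :: "'m \<times> ('x \<Rightarrow>\<^sub>0 nat) \<Rightarrow> int" where
  "mondeg u = hdeg Gr (fst u) + int (mdeg (snd u))"

definition hcomp :: "int \<Rightarrow> ('x, 'k, 'm) fvec \<Rightarrow> ('x, 'k, 'm) fvec" where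
  "hcomp c = frestrict {u. mondeg u = c}"

lemma finite_G: "finite G"
  and G_homogeneous: "G \<subseteq> (\<Union>a. Gr a)"
  and G_generates: "generated_submodule (poly_ring X) M G = carrier M"
  using min_gens by (auto simp: minimal_hom_gens_def)

lemma G_subset: "G \<subseteq> carrier M"
  using G_homogeneous Gr_subset by blast

text \<open>Zero could be dropped without changing the generated submodule, contrary to minimality.
  The point matters because zero lies in every \<open>Gr a\<close>, so \<open>hdeg\<close> is
  meaningful only for nonzero generators.\<close>

lemma zero_notin_G: "\<zero>\<^bsub>M\<^esub> \<notin> G"
proof
  assume zero: "\<zero>\<^bsub>M\<^esub> \<in> G"
  have "G \<subseteq> N \<longleftrightarrow> G - {\<zero>\<^bsub>M\<^esub>} \<subseteq> N" if "submodule N (poly_ring X) M" for N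
    using that subgroup.one_closed[of N "add_monoid M"] by (auto simp: submodule_def)
  then have "generated_submodule (poly_ring X) M (G - {\<zero>\<^bsub>M\<^esub>}) = generated_submodule (poly_ring X) M G"
    unfolding generated_submodule_def by (intro arg_cong[where f = Inter]) blast
  moreover have "G - {\<zero>\<^bsub>M\<^esub>} \<subset> G" using zero by blast
  ultimately show False using min_gens by (auto simp: minimal_hom_gens_def)
qed

lemma gen_in_Gr: "g \<in> G \<Longrightarrow> g \<in> Gr (hdeg Gr g)"
  using G_homogeneous zero_notin_G by (intro hdeg_in) auto

lemma free_comp_iff: "f \<in> free_comp X Gr G c \<longleftrightarrow> f \<in> F \<and> (\<forall>u\<in>supp f. mondeg u = c)"
  by (auto simp: free_comp_def mondeg_def)

lemma F_lookup: "f \<in> F \<Longrightarrow> lookup f g \<in> carrier (poly_ring X)"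
  by (simp add: free_module_def)

lemma F_add: "f \<in> F \<Longrightarrow> f' \<in> F \<Longrightarrow> f + f' \<in> F"
  and F_zero: "0 \<in> F"
  and F_kscale: "f \<in> F \<Longrightarrow> kscale c f \<in> F"
  and F_sum: "(\<And>i. i \<in> I \<Longrightarrow> h i \<in> F) \<Longrightarrow> (\<Sum>i\<in>I. h i) \<in> F"
proof -
  have "F = {f. supp f \<subseteq> monomials X G}" by (simp add: set_eq_iff carrier_free_module_iff)
  then have "fvec.subspace F" by (simp add: subspace_supp)
  then show "f \<in> F \<Longrightarrow> f' \<in> F \<Longrightarrow> f + f' \<in> F" "0 \<in> F"
    "f \<in> F \<Longrightarrow> kscale c f \<in> F" "(\<And>i. i \<in> I \<Longrightarrow> h i \<in> F) \<Longrightarrow> (\<Sum>i\<in>I. h i) \<in> F"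
    by (auto intro: fvec.subspace_add fvec.subspace_0 fvec.subspace_scale fvec.subspace_sum)
qed

lemma hcomp_free_comp: "f \<in> F \<Longrightarrow> hcomp c f \<in> free_comp X Gr G c"
  by (auto simp: free_comp_iff hcomp_def carrier_free_module_iff supp_frestrict)

lemma sum_hcomp:
  assumes "finite D" "mondeg ` supp f \<subseteq> D"
  shows "f = (\<Sum>a\<in>D. hcomp a f)"
proof (rule fvec_eqI)
  fix u
  have "fcoeff f u = (\<Sum>a\<in>D. if mondeg u = a then fcoeff f u else 0)"
  proof (cases "u \<in> supp f")
    case True
    with assms show ?thesis by auto
  next
    case False
    then have "fcoeff f u = 0" by (simp add: supp_iff)
    then show ?thesis by (simp only: if_cancel sum.neutral_const)
  qed
  then show "fcoeff f u = fcoeff (\<Sum>a\<in>D. hcomp a f) u"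
    by (simp add: fcoeff_sum hcomp_def fcoeff_frestrict)
qed

lemma smult_gen_closed: "f \<in> F \<Longrightarrow> g \<in> G \<Longrightarrow> lookup f g \<odot>\<^bsub>M\<^esub> g \<in> carrier M"
  using F_lookup G_subset by blast

lemma \<phi>_closed: "f \<in> F \<Longrightarrow> \<phi> f \<in> carrier M"
  unfolding min_epi_def by (rule M.finsum_closed) (auto intro: smult_gen_closed)

lemma \<phi>_add: "f \<in> F \<Longrightarrow> f' \<in> F \<Longrightarrow> \<phi> (f + f') = \<phi> f \<oplus>\<^bsub>M\<^esub> \<phi> f'"
proof -
  assume f: "f \<in> F" "f' \<in> F"
  have "\<phi> (f + f') = finsum M (\<lambda>g. lookup f g \<odot>\<^bsub>M\<^esub> g \<oplus>\<^bsub>M\<^esub> lookup f' g \<odot>\<^bsub>M\<^esub> g) G"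
    unfolding min_epi_def
  proof (rule M.finsum_cong')
    fix g assume g: "g \<in> G"
    then show "lookup (f + f') g \<odot>\<^bsub>M\<^esub> g = lookup f g \<odot>\<^bsub>M\<^esub> g \<oplus>\<^bsub>M\<^esub> lookup f' g \<odot>\<^bsub>M\<^esub> g"
      using M.smult_l_distr[of "lookup f g" "lookup f' g" g] f F_lookup G_subset
      by (auto simp: lookup_add poly_ring_simps)
  qed (use f smult_gen_closed in auto)
  also have "\<dots> = \<phi> f \<oplus>\<^bsub>M\<^esub> \<phi> f'"
    unfolding min_epi_def using f smult_gen_closed by (intro M.finsum_addf) auto
  finally show ?thesis .
qed

lemma \<phi>_fscale: "p \<in> carrier (poly_ring X) \<Longrightarrow> f \<in> F \<Longrightarrow> \<phi> (fscale p f) = p \<odot>\<^bsub>M\<^esub> \<phi> f"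
proof -
  assume p: "p \<in> carrier (poly_ring X)" and f: "f \<in> F"
  have "\<phi> (fscale p f) = finsum M (\<lambda>g. p \<odot>\<^bsub>M\<^esub> (lookup f g \<odot>\<^bsub>M\<^esub> g)) G"
    unfolding min_epi_def
  proof (rule M.finsum_cong')
    fix g assume g: "g \<in> G"
    then show "lookup (fscale p f) g \<odot>\<^bsub>M\<^esub> g = p \<odot>\<^bsub>M\<^esub> (lookup f g \<odot>\<^bsub>M\<^esub> g)"
      using M.smult_assoc1[of p "lookup f g" g] p f F_lookup G_subset
      by (auto simp: lookup_fscale poly_ring_simps)
  qed (use p f smult_gen_closed in auto)
  also have "\<dots> = p \<odot>\<^bsub>M\<^esub> \<phi> f"
    unfolding min_epi_def using p f smult_gen_closed finite_G
    by (intro M.finsum_smult_ldistr[symmetric]) auto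
  finally show ?thesis .
qed

lemma \<phi>_kscale: "f \<in> F \<Longrightarrow> \<phi> (kscale c f) = const c \<odot>\<^bsub>M\<^esub> \<phi> f"
  unfolding kscale_def by (rule \<phi>_fscale[OF const_in_poly_ring])

lemma \<phi>_zero: "\<phi> 0 = \<zero>\<^bsub>M\<^esub>"
  using \<phi>_fscale[of 0 0] \<phi>_closed[OF F_zero] F_zero
  by (simp add: carrier_poly_ring_iff fscale_simps smult_zero_left)

lemma \<phi>_homogeneous:
  assumes "f \<in> free_comp X Gr G c"
  shows "\<phi> f \<in> Gr c"
  unfolding min_epi_def
proof (rule Gr_finsum[OF finite_G])
  fix g assume g: "g \<in> G"
  show "lookup f g \<odot>\<^bsub>M\<^esub> g \<in> Gr c"
  proof (cases "lookup f g = 0")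
    case True
    then show ?thesis using g G_subset Gr_zero smult_zero_left by auto
  next
    case False
    have deg: "hdeg Gr g + int (mdeg \<alpha>) = c" if "\<alpha> \<in> keys (lookup f g)" for \<alpha>
      using assms that unfolding free_comp_iff mondeg_def supp_def
      by (auto simp: lookup_not_eq_zero_eq_in_keys)
    \<comment> \<open>An exponent that really occurs shows that \<open>c - hdeg Gr g\<close> is
      nonnegative, so \<open>nat\<close> below loses nothing.\<close>
    obtain \<alpha> where \<alpha>: "\<alpha> \<in> keys (lookup f g)" using False by (metis ex_in_conv keys_eq_empty)
    have "lookup f g \<in> poly_comp X (nat (c - hdeg Gr g))"
      using assms deg F_lookup by (force simp: poly_comp_def free_comp_iff)
    moreover have "int (nat (c - hdeg Gr g)) + hdeg Gr g = c" using deg[OF \<alpha>] by simp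
    ultimately show ?thesis using comp_smult gen_in_Gr[OF g] by metis
  qed
qed

lemma \<phi>_sum:
  "finite D \<Longrightarrow> (\<And>a. a \<in> D \<Longrightarrow> h a \<in> F) \<Longrightarrow> \<phi> (\<Sum>a\<in>D. h a) = finsum M (\<lambda>a. \<phi> (h a)) D"
proof (induction D rule: finite_induct)
  case empty
  then show ?case by (simp add: \<phi>_zero)
next
  case (insert a D)
  then have "(\<lambda>a. \<phi> (h a)) \<in> D \<rightarrow> carrier M" "\<phi> (h a) \<in> carrier M" using \<phi>_closed by auto
  with insert show ?case by (simp add: \<phi>_add F_sum)
qed

text \<open>\<phi> preserves degrees, so it maps the decomposition of \<open>f\<close> to a
  homogeneous decomposition of its image, to which \<open>components_unique\<close> applies.\<close>

lemma \<phi>_hcomp: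
  assumes "f \<in> F" "\<phi> f \<in> Gr c"
  shows "\<phi> (hcomp a f) = (if a = c then \<phi> f else \<zero>\<^bsub>M\<^esub>)"
proof -
  \<comment> \<open>The degrees \<open>a\<close> and \<open>c\<close> are added so that they index
    summands even if \<open>f\<close> has no monomial there.\<close>
  let ?D = "mondeg ` supp f \<union> {a, c}"
  have D: "finite ?D" "mondeg ` supp f \<subseteq> ?D" using finite_supp by blast+
  have comp: "hcomp a f \<in> free_comp X Gr G a" for a using assms(1) by (rule hcomp_free_comp)
  have "\<phi> f = \<phi> (\<Sum>a\<in>?D. hcomp a f)" by (rule arg_cong[OF sum_hcomp[OF D]])
  also have "\<dots> = finsum M (\<lambda>a. \<phi> (hcomp a f)) ?D"
    using D comp by (intro \<phi>_sum) (auto simp: free_comp_iff)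
  finally have eq: "\<phi> f = finsum M (\<lambda>a. \<phi> (hcomp a f)) ?D" .
  show ?thesis
    unfolding eq using D assms(2) eq
    by (intro components_unique[of ?D "\<lambda>a. \<phi> (hcomp a f)"] \<phi>_homogeneous comp) auto
qed

text \<open>The kernel is graded because zero lies in every \<open>Gr c\<close>. This is what allows
  division by kernel elements to stay within one degree.\<close>

lemma Q_hcomp: "f \<in> Q \<Longrightarrow> hcomp c f \<in> Q"
  using \<phi>_hcomp[of f c c] Gr_zero hcomp_free_comp[of f c] by (auto simp: epi_kernel_def free_comp_iff)

lemma subspace_Q: "fvec.subspace Q"
proof -
  have "const c \<odot>\<^bsub>M\<^esub> \<zero>\<^bsub>M\<^esub> = \<zero>\<^bsub>M\<^esub>" for c
    using M.smult_r_null[OF const_in_poly_ring] .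
  then show ?thesis
    by (auto simp: fvec.subspace_def epi_kernel_def F_zero F_add F_kscale \<phi>_zero \<phi>_add \<phi>_kscale)
qed

lemma xmult_Q:
  assumes "f \<in> Q" "keys \<beta> \<subseteq> X"
  shows "xmult \<beta> f \<in> Q"
proof -
  have "Poly_Mapping.single \<beta> (1 :: 'k) \<in> carrier (poly_ring X)" using assms(2) by (rule single_in_poly_ring)
  then show ?thesis using assms(1) M.smult_r_null
    by (auto simp: epi_kernel_def xmult_def \<phi>_fscale fscale_in_free_module)
qed

text \<open>The image is a submodule containing \<open>G\<close>, because the basis vector indexed
  by \<open>g\<close> is mapped to \<open>g\<close>.\<close>

lemma \<phi>_surj: "m \<in> carrier M \<Longrightarrow> \<exists>f\<in>F. \<phi> f = m"
proof -
  have "submodule (\<phi> ` F) (poly_ring X) M"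
  proof (rule M.submoduleI)
    show "\<phi> ` F \<subseteq> carrier M" using \<phi>_closed by blast
    show "\<zero>\<^bsub>M\<^esub> \<in> \<phi> ` F" using \<phi>_zero F_zero by force
    show smult: "p \<odot>\<^bsub>M\<^esub> m \<in> \<phi> ` F" if "p \<in> carrier (poly_ring X)" "m \<in> \<phi> ` F" for p m
      using that fscale_in_free_module by (force simp flip: \<phi>_fscale)
    show "m \<oplus>\<^bsub>M\<^esub> m' \<in> \<phi> ` F" if "m \<in> \<phi> ` F" "m' \<in> \<phi> ` F" for m m'
      using that F_add by (force simp flip: \<phi>_add)
    show "\<ominus>\<^bsub>M\<^esub> m \<in> \<phi> ` F" if m: "m \<in> \<phi> ` F" for m
    proof -
      have "m \<in> carrier M" using m \<phi>_closed by blast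
      then have "\<ominus>\<^bsub>M\<^esub> m = (\<ominus>\<^bsub>poly_ring X\<^esub> \<one>\<^bsub>poly_ring X\<^esub>) \<odot>\<^bsub>M\<^esub> m"
        by (simp add: M.smult_l_minus)
      then show ?thesis using smult m by auto
    qed
  qed
  moreover have "G \<subseteq> \<phi> ` F"
  proof
    fix g assume g: "g \<in> G"
    let ?f = "Poly_Mapping.single g 1 :: ('x, 'k, 'm) fvec"
    have "?f \<in> F" using g by (auto simp: free_module_def lookup_single when_def carrier_poly_ring_iff)
    moreover have "\<phi> ?f = finsum M (\<lambda>g'. if g = g' then g' else \<zero>\<^bsub>M\<^esub>) G"
      unfolding min_epi_def using G_subset M.smult_one
      by (intro M.finsum_cong') (auto simp: lookup_single when_def smult_zero_left poly_ring_simps)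
    moreover have "\<dots> = g"
      using g G_subset finite_G by (intro M.add.finprod_singleton) auto
    ultimately show "g \<in> \<phi> ` F" by (metis image_eqI)
  qed
  ultimately have "carrier M \<subseteq> \<phi> ` F"
    using generated_submodule_subset G_generates by blast
  then show "m \<in> carrier M \<Longrightarrow> \<exists>f\<in>F. \<phi> f = m" by blast
qed

lemma \<phi>_surj_homogeneous:
  assumes "m \<in> Gr c"
  shows "\<exists>f\<in>free_comp X Gr G c. \<phi> f = m"
proof -
  obtain f where f: "f \<in> F" "\<phi> f = m" using \<phi>_surj assms Gr_subset by blast
  then have "\<phi> (hcomp c f) = m" using \<phi>_hcomp[of f c c] assms by simp
  then show ?thesis using hcomp_free_comp[OF f(1)] by blast
qed

end


section \<open>Macaulay bases\<close>

context macaulay_setup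
begin

section \<open>Initial monomials and the normal space\<close>

lemma r_trans: "(u, v) \<in> r \<Longrightarrow> (v, w) \<in> r \<Longrightarrow> (u, w) \<in> r"
  and r_irrefl: "(u, u) \<notin> r"
  and r_total: "u \<in> monomials X G \<Longrightarrow> v \<in> monomials X G \<Longrightarrow> u \<noteq> v \<Longrightarrow> (u, v) \<in> r \<or> (v, u) \<in> r"
  and r_shift: "((g, \<alpha>), (g', \<alpha>')) \<in> r \<Longrightarrow> keys \<beta> \<subseteq> X \<Longrightarrow> ((g, \<beta> + \<alpha>), (g', \<beta> + \<alpha>')) \<in> r"
  using order unfolding monomial_order_def strict_linear_order_on_def total_on_def irrefl_def
  by (blast dest: transD)+

lemma max_monomial_exists:
  assumes "finite A" "A \<noteq> {}" "A \<subseteq> monomials X G"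
  shows "\<exists>u\<in>A. \<forall>v\<in>A. v \<noteq> u \<longrightarrow> (v, u) \<in> r"
  using assms
proof (induction A rule: finite_ne_induct)
  case (singleton u)
  then show ?case by simp
next
  case (insert u A)
  then obtain w where w: "w \<in> A" "\<forall>v\<in>A. v \<noteq> w \<longrightarrow> (v, w) \<in> r" by auto
  then have "u \<noteq> w" using insert by blast
  then consider "(u, w) \<in> r" | "(w, u) \<in> r" using r_total insert.prems w by blast
  then show ?case
  proof cases
    case 1
    then show ?thesis using w by blast
  next
    case 2
    have "(v, u) \<in> r" if "v \<in> A" for v
      using w(2) 2 r_trans[of v w u] that by (cases "v = w") auto
    then show ?thesis by blast
  qed
qed

lemma initial_monomial_eqI:
  assumes "u \<in> supp f" "\<And>v. v \<in> supp f \<Longrightarrow> v \<noteq> u \<Longrightarrow> (v, u) \<in> r"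
  shows "initial_monomial r f = u"
  unfolding initial_monomial_def
proof (rule the_equality)
  fix w assume w: "w \<in> supp f \<and> (\<forall>v\<in>supp f. v \<noteq> w \<longrightarrow> (v, w) \<in> r)"
  show "w = u"
  proof (rule ccontr)
    assume "w \<noteq> u"
    then have "(u, w) \<in> r" "(w, u) \<in> r" using w assms(1) assms(2)[of w] by auto
    from r_trans[OF this] show False using r_irrefl by simp
  qed
qed (use assms in blast)

lemma initial_monomial:
  assumes "f \<in> F" "f \<noteq> 0"
  shows "initial_monomial r f \<in> supp f"
    and "v \<in> supp f \<Longrightarrow> v \<noteq> initial_monomial r f \<Longrightarrow> (v, initial_monomial r f) \<in> r"
proof -
  have "\<exists>u\<in>supp f. \<forall>v\<in>supp f. v \<noteq> u \<longrightarrow> (v, u) \<in> r"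
    using assms by (intro max_monomial_exists) (simp_all add: finite_supp carrier_free_module_iff supp_empty_iff)
  then obtain u where u: "u \<in> supp f" "\<forall>v\<in>supp f. v \<noteq> u \<longrightarrow> (v, u) \<in> r" by blast
  then have "initial_monomial r f = u" by (intro initial_monomial_eqI) auto
  with u show "initial_monomial r f \<in> supp f"
    "v \<in> supp f \<Longrightarrow> v \<noteq> initial_monomial r f \<Longrightarrow> (v, initial_monomial r f) \<in> r" by auto
qed

definition leads :: "('m \<times> ('x \<Rightarrow>\<^sub>0 nat)) set" where
  "leads = {initial_monomial r f | f. f \<in> Q \<and> f \<noteq> 0}"

lemma Q_subset: "Q \<subseteq> F"
  by (auto simp: epi_kernel_def)

text \<open>Multiplication by a monomial respects the order, so it shifts the initial monomial, and
  it keeps the vector in \<open>Q\<close>.\<close>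

lemma leads_shift:
  assumes "(g, \<alpha>) \<in> leads" "keys \<beta> \<subseteq> X"
  shows "(g, \<beta> + \<alpha>) \<in> leads"
proof -
  obtain f where f: "f \<in> Q" "f \<noteq> 0" "initial_monomial r f = (g, \<alpha>)"
    using assms(1) by (auto simp: leads_def)
  then have "f \<in> F" using Q_subset by blast
  note ini = initial_monomial[OF this f(2), unfolded f(3)]
  have supp: "(g, \<beta> + \<alpha>) \<in> supp (xmult \<beta> f)" using ini(1) by (force simp: supp_xmult)
  moreover have "initial_monomial r (xmult \<beta> f) = (g, \<beta> + \<alpha>)"
  proof (rule initial_monomial_eqI[OF supp])
    fix v assume "v \<in> supp (xmult \<beta> f)" "v \<noteq> (g, \<beta> + \<alpha>)"
    then obtain g' \<alpha>' where "v = (g', \<beta> + \<alpha>')" "(g', \<alpha>') \<in> supp f" "(g', \<alpha>') \<noteq> (g, \<alpha>)"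
      by (auto simp: supp_xmult)
    then show "(v, (g, \<beta> + \<alpha>)) \<in> r" using ini(2) r_shift assms(2) by blast
  qed
  moreover have "xmult \<beta> f \<noteq> 0" using supp by auto
  ultimately show ?thesis using xmult_Q[OF f(1) assms(2)] by (force simp: leads_def)
qed

text \<open>By \<open>leads_shift\<close> the vectors supported on \<open>leads\<close> form a
  submodule, so generating a submodule from the initial monomials creates no further
  monomials.\<close>

lemma monom_vec_in_initial_module_iff: "monom_vec u \<in> initial_module X G r Q \<longleftrightarrow> u \<in> leads"
proof
  assume "u \<in> leads"
  then show "monom_vec u \<in> initial_module X G r Q"
    by (auto simp: initial_module_def generated_submodule_def leads_def)
next
  let ?N = "{f \<in> F. supp f \<subseteq> leads}"
  have "leads \<subseteq> monomials X G"
    using initial_monomial(1) Q_subset by (fastforce simp: leads_def carrier_free_module_iff)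
  then have "{monom_vec (initial_monomial r f) | f. f \<in> Q \<and> f \<noteq> 0} \<subseteq> ?N"
    by (auto simp: leads_def carrier_free_module_iff)
  moreover have "submodule ?N (poly_ring X) (free_module X G)"
  proof (rule submodule_free_module)
    fix p :: "('x, 'k) mpoly" and f assume p: "p \<in> carrier (poly_ring X)" and f: "f \<in> ?N"
    have "supp (fscale p f) \<subseteq> leads"
    proof
      fix u assume "u \<in> supp (fscale p f)"
      then obtain g \<alpha> \<beta> where "u = (g, \<alpha> + \<beta>)" "\<alpha> \<in> keys p" "(g, \<beta>) \<in> supp f"
        using subsetD[OF supp_fscale] by blast
      then show "u \<in> leads" using leads_shift p f by (auto simp: carrier_poly_ring_iff)
    qed
    then show "fscale p f \<in> ?N" using p f fscale_in_free_module by blast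
  next
    fix f f' assume "f \<in> ?N" "f' \<in> ?N"
    then show "f + f' \<in> ?N" using supp_add[of f f'] F_add by blast
  qed (auto simp: F_zero)
  ultimately have "initial_module X G r Q \<subseteq> ?N"
    unfolding initial_module_def by (intro generated_submodule_subset)
  moreover assume "monom_vec u \<in> initial_module X G r Q"
  ultimately have "supp (monom_vec u :: ('x, 'k, 'm) fvec) \<subseteq> leads" by blast
  then show "u \<in> leads" by simp
qed

abbreviation N :: "('x, 'k, 'm) fvec set" where
  "N \<equiv> normal_space X M G r"

text \<open>In particular \<open>N\<close> meets \<open>Q\<close> only in 0, since a nonzero element
  of \<open>Q\<close> has its initial monomial in \<open>leads\<close>. Injectivity of \<phi> will
  come from this.\<close>

lemma N_iff: "f \<in> N \<longleftrightarrow> supp f \<subseteq> monomials X G - leads"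
  by (auto simp: normal_space_def monom_vec_in_initial_module_iff carrier_free_module_iff)

abbreviation homogeneous :: "int \<Rightarrow> ('x, 'k, 'm) fvec set" where
  "homogeneous c \<equiv> free_comp X Gr G c"

lemma homogeneous_iff: "f \<in> homogeneous c \<longleftrightarrow> supp f \<subseteq> {u \<in> monomials X G. mondeg u = c}"
  by (auto simp: free_comp_iff carrier_free_module_iff)

lemma subspace_N_homogeneous: "fvec.subspace (N \<inter> homogeneous c)"
proof -
  have "homogeneous c = {f. supp f \<subseteq> {u \<in> monomials X G. mondeg u = c}}"
    by (simp add: set_eq_iff homogeneous_iff)
  then have hom: "fvec.subspace (homogeneous c)" by (simp add: subspace_supp)
  have "N = {f. supp f \<subseteq> monomials X G - leads}"
    by (simp add: set_eq_iff N_iff)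
  then have "fvec.subspace N" by (simp add: subspace_supp)
  then show "fvec.subspace (N \<inter> homogeneous c)" using hom by (rule fvec.subspace_inter)
qed

lemma finite_homogeneous_monomials: "finite {u \<in> monomials X G. mondeg u = c}"
proof (rule finite_subset)
  show "{u \<in> monomials X G. mondeg u = c} \<subseteq> (SIGMA g:G. exponents X (nat (c - hdeg Gr g)))"
    by (auto simp: monomials_def mondeg_def exponents_def)
qed (auto simp: finite_G finite_exponents finite_vars)

text \<open>Division with remainder, carried out on single monomials by induction along
  \<open>r\<close> and then extended linearly. A monomial outside \<open>leads\<close> is its own
  remainder; one in \<open>leads\<close> is rewritten modulo \<open>Q\<close> by smaller monomials
  of the same degree.\<close>

lemma homogeneous_decompose:
  assumes "f \<in> homogeneous c"
  shows "\<exists>n\<in>N \<inter> homogeneous c. \<exists>q\<in>Q. f = n + q"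
proof -
  let ?T = "{u \<in> monomials X G. mondeg u = c}"
  let ?W = "{n + q | n q. n \<in> N \<inter> homogeneous c \<and> q \<in> Q}"
  have W: "fvec.subspace ?W" by (rule fvec.subspace_sums[OF subspace_N_homogeneous subspace_Q])
  have "acyclic r"
    using order by (auto simp: monomial_order_def strict_linear_order_on_def acyclic_irrefl)
  then have "acyclic (r \<inter> ?T \<times> ?T)" by (rule acyclic_subset) blast
  then have wf: "wf (r \<inter> ?T \<times> ?T)"
    using finite_homogeneous_monomials by (intro finite_acyclic_wf) auto
  have monom: "u \<in> ?T \<Longrightarrow> monom_vec u \<in> ?W" for u
    using wf
  proof (induction u rule: wf_induct_rule)
    case (less u)
    show ?case
    proof (cases "u \<in> leads")
      case False
      then have "(monom_vec u :: ('x, 'k, 'm) fvec) \<in> N \<inter> homogeneous c"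
        using less.prems by (auto simp: N_iff homogeneous_iff)
      moreover have "monom_vec u = monom_vec u + (0 :: ('x, 'k, 'm) fvec)" by simp
      ultimately show ?thesis using fvec.subspace_0[OF subspace_Q] by blast
    next
      case True
      then obtain f where f: "f \<in> Q" "f \<noteq> 0" "initial_monomial r f = u" by (auto simp: leads_def)
      then have fF: "f \<in> F" using Q_subset by blast
      note ini = initial_monomial[OF fF f(2), unfolded f(3)]
      \<comment> \<open>Passing to the component of degree \<open>c\<close> stays in
        \<open>Q\<close> and keeps \<open>u\<close>, which has that degree. All other monomials left
        are below \<open>u\<close> and of degree \<open>c\<close>, so the induction hypothesis
        covers them.\<close>
      let ?q = "hcomp c f"
      have supp_q: "supp ?q = supp f \<inter> {u. mondeg u = c}" by (simp add: hcomp_def supp_frestrict)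
      have u: "u \<in> supp ?q" using ini(1) less.prems by (simp add: supp_q)
      have below: "v \<in> ?T \<and> (v, u) \<in> r \<inter> ?T \<times> ?T" if "v \<in> supp ?q - {u}" for v
        using that ini(2) less.prems fF by (auto simp: supp_q carrier_free_module_iff)
      let ?S = "\<Sum>v\<in>supp ?q - {u}. kscale (fcoeff ?q v) (monom_vec v)"
      have "?q = kscale (fcoeff ?q u) (monom_vec u) + ?S"
        using fvec_eq_sum_monom_vec[of ?q] sum.remove[OF finite_supp u] by metis
      then have "kscale (fcoeff ?q u) (monom_vec u) = ?q - ?S" by (simp add: algebra_simps)
      moreover have "?S \<in> ?W"
        using less.IH below by (intro fvec.subspace_sum[OF W] fvec.subspace_scale[OF W]) blast
      moreover have "?q \<in> ?W"
        using Q_hcomp[OF f(1)] fvec.subspace_0[OF subspace_N_homogeneous] by force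
      ultimately have "kscale (fcoeff ?q u) (monom_vec u) \<in> ?W"
        using fvec.subspace_diff[OF W] by simp
      then have "kscale (inverse (fcoeff ?q u)) (kscale (fcoeff ?q u) (monom_vec u)) \<in> ?W"
        by (rule fvec.subspace_scale[OF W])
      moreover have "fcoeff ?q u \<noteq> 0" using u by (simp add: supp_iff)
      ultimately show ?thesis by simp
    qed
  qed
  have "(\<Sum>u\<in>supp f. kscale (fcoeff f u) (monom_vec u)) \<in> ?W"
    using assms monom by (intro fvec.subspace_sum[OF W] fvec.subspace_scale[OF W]) (auto simp: homogeneous_iff)
  then show ?thesis unfolding fvec_eq_sum_monom_vec[of f, symmetric] by blast
qed

text \<open>
  Macaulay's basis theorem in a single degree. Each degree has only finitely many monomials, so the
  division argument terminates without knowing that the monomial order is a well-order.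
\<close>

lemma bij_betw_\<phi>: "bij_betw \<phi> (N \<inter> homogeneous c) (Gr c)"
proof (rule bij_betw_imageI)
  have inF: "f \<in> F" if "f \<in> homogeneous c" for f using that by (simp add: free_comp_iff)
  show "inj_on \<phi> (N \<inter> homogeneous c)"
  proof (rule inj_onI, rule ccontr)
    fix f f' assume f: "f \<in> N \<inter> homogeneous c" "f' \<in> N \<inter> homogeneous c" "\<phi> f = \<phi> f'" "f \<noteq> f'"
    have "f - f' \<in> N \<inter> homogeneous c" using f fvec.subspace_diff[OF subspace_N_homogeneous] by blast
    then have N: "f - f' \<in> N" and F: "f - f' \<in> F" using inF by blast+
    have "\<phi> (f - f') \<oplus>\<^bsub>M\<^esub> \<phi> f' = \<phi> (f - f' + f')"
      using f F inF by (intro \<phi>_add[symmetric]) auto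
    then have "\<phi> (f - f') \<oplus>\<^bsub>M\<^esub> \<phi> f' = \<phi> f'" using f(3) by simp
    then have "\<phi> (f - f') = \<zero>\<^bsub>M\<^esub>" 
      using M.add.r_cancel_one[of "\<phi> f'" "\<phi> (f - f')"] f(2) F inF \<phi>_closed by blast
    then have "f - f' \<in> Q" using F by (simp add: epi_kernel_def)
    moreover have "f - f' \<noteq> 0" using f(4) by simp
    ultimately have "initial_monomial r (f - f') \<in> leads \<inter> supp (f - f')"
      using initial_monomial(1)[OF F] by (auto simp: leads_def)
    then show False using N by (auto simp: N_iff)
  qed
  show "\<phi> ` (N \<inter> homogeneous c) = Gr c"
  proof
    show "\<phi> ` (N \<inter> homogeneous c) \<subseteq> Gr c" using \<phi>_homogeneous by blast
    show "Gr c \<subseteq> \<phi> ` (N \<inter> homogeneous c)"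
    proof
      fix m assume "m \<in> Gr c"
      then obtain f where f: "f \<in> homogeneous c" "\<phi> f = m" using \<phi>_surj_homogeneous by blast
      then obtain n q where nq: "n \<in> N \<inter> homogeneous c" "q \<in> Q" "f = n + q"
        using homogeneous_decompose by blast
      then have "m = \<phi> n \<oplus>\<^bsub>M\<^esub> \<phi> q" using f \<phi>_add inF Q_subset by blast
      then have "m = \<phi> n" using nq inF \<phi>_closed by (simp add: epi_kernel_def)
      then show "m \<in> \<phi> ` (N \<inter> homogeneous c)" using nq by blast
    qed
  qed
qed

lemma linear_coordinates_\<phi>: "linear_coordinates kscale X M (N \<inter> homogeneous c) (Gr c) \<phi>"
proof (intro linear_coordinates.intro linear_coordinates_axioms.intro)
  show "vector_space (kscale :: 'k \<Rightarrow> ('x, 'k, 'm) fvec \<Rightarrow> _)" by (rule fvec.vector_space_axioms)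
qed (auto simp: module subspace_N_homogeneous Gr_subset[THEN subsetD] bij_betw_\<phi> free_comp_iff
    intro: \<phi>_add \<phi>_kscale)

text \<open>The free module is torsion-free. In the component of a basis element \<open>g\<close>
  where \<open>h\<close> is nonzero, \<open>r\<close> induces an order on exponents compatible with
  addition, and the product of the two leading terms cannot cancel.\<close>

lemma fscale_eq_0D:
  assumes "p \<in> carrier (poly_ring X)" "h \<in> F" "h \<noteq> 0" "fscale p h = 0"
  shows "p = 0"
proof (rule ccontr)
  assume "p \<noteq> 0"
  obtain g \<beta>' where "(g, \<beta>') \<in> supp h" using assms(3) supp_empty_iff by fastforce
  then have g: "g \<in> G" using assms(2) by (auto simp: carrier_free_module_iff monomials_def)
  let ?q = "lookup h g"
  have keys_nonempty: "keys ?q \<noteq> {}" "keys p \<noteq> {}"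
    using \<open>p \<noteq> 0\<close> \<open>(g, \<beta>') \<in> supp h\<close> by (auto simp: supp_def)
  have X: "keys \<alpha> \<subseteq> X" if "\<alpha> \<in> keys p \<or> \<alpha> \<in> keys ?q" for \<alpha>
    using that assms(1) F_lookup[OF assms(2), of g] by (auto simp: carrier_poly_ring_iff)
  have max: "\<exists>\<alpha>\<in>A. \<forall>\<alpha>'\<in>A. \<alpha>' \<noteq> \<alpha> \<longrightarrow> ((g, \<alpha>'), (g, \<alpha>)) \<in> r"
    if "finite A" "A \<noteq> {}" "\<And>\<alpha>. \<alpha> \<in> A \<Longrightarrow> keys \<alpha> \<subseteq> X" for A
    using max_monomial_exists[of "Pair g ` A"] that g by (auto simp: monomials_def)
  obtain \<alpha>0 where \<alpha>0: "\<alpha>0 \<in> keys p" "\<forall>\<alpha>\<in>keys p. \<alpha> \<noteq> \<alpha>0 \<longrightarrow> ((g, \<alpha>), (g, \<alpha>0)) \<in> r"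
    using max[of "keys p"] X keys_nonempty by auto
  obtain \<beta>0 where \<beta>0: "\<beta>0 \<in> keys ?q" "\<forall>\<beta>\<in>keys ?q. \<beta> \<noteq> \<beta>0 \<longrightarrow> ((g, \<beta>), (g, \<beta>0)) \<in> r"
    using max[of "keys ?q"] X keys_nonempty by auto
  have "lookup (p * ?q) (\<alpha>0 + \<beta>0) = lookup p \<alpha>0 * lookup ?q \<beta>0"
  proof (rule lookup_mult_unique_decomposition[OF _ \<alpha>0(1)], rule ccontr)
    fix \<alpha> \<beta> assume \<alpha>\<beta>: "\<alpha> \<in> keys p" "\<beta> \<in> keys ?q" "\<alpha> + \<beta> = \<alpha>0 + \<beta>0" "\<alpha> \<noteq> \<alpha>0"
    \<comment> \<open>Replacing the exponents by the leading ones, one after the other, increases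
      the sum strictly, although the two sums were assumed equal.\<close>
    then have "((g, \<beta> + \<alpha>), (g, \<beta> + \<alpha>0)) \<in> r" using \<alpha>0 X by (intro r_shift) blast+
    moreover have "\<beta> \<noteq> \<beta>0" using \<alpha>\<beta> by auto
    then have "((g, \<alpha>0 + \<beta>), (g, \<alpha>0 + \<beta>0)) \<in> r" using \<alpha>0(1) \<beta>0 X \<alpha>\<beta> by (intro r_shift) blast+
    ultimately show False using \<alpha>\<beta>(3) r_trans r_irrefl by (metis add.commute)
  qed
  moreover have "p * ?q = 0" using assms(4) lookup_fscale[of p h g] by simp
  ultimately show False using \<alpha>0(1) \<beta>0(1) by (simp add: in_keys_iff)
qed

end


section \<open>Cone decompositions and the Hilbert polynomial\<close>

locale macaulay_cones = macaulay_setup X M Gr G r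
  for X :: "'x set" and M :: "(('x, 'k::field) mpoly, 'm) module" and Gr G r +
  fixes P :: "(('x, 'k, 'm) fvec \<times> 'x set) set"
  assumes cones: "cone_decomposition X M Gr G r P"
begin

abbreviation deg :: "('x, 'k, 'm) fvec \<times> 'x set \<Rightarrow> int" where
  "deg \<equiv> cdeg X Gr G"

lemma finite_P: "finite P"
  and generator_nonzero: "C \<in> P \<Longrightarrow> fst C \<noteq> 0"
  and generator_homogeneous: "C \<in> P \<Longrightarrow> \<exists>c. fst C \<in> homogeneous c"
  and cone_vars: "C \<in> P \<Longrightarrow> snd C \<subseteq> X"
  and cone_subset: "C \<in> P \<Longrightarrow> cone C \<subseteq> N"
  and cone_sum: "f \<in> N \<Longrightarrow> \<exists>!w. w \<in> (\<Pi>\<^sub>E C\<in>P. cone C) \<and> f = (\<Sum>C\<in>P. w C)"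
  using cones unfolding cone_decomposition_def by (auto simp: case_prod_beta)

lemma generator_in: "C \<in> P \<Longrightarrow> fst C \<in> homogeneous (deg C)"
proof -
  assume C: "C \<in> P"
  then obtain c where c: "fst C \<in> homogeneous c" using generator_homogeneous by blast
  obtain u where u: "u \<in> supp (fst C)" using generator_nonzero[OF C] supp_empty_iff by blast
  have "a = mondeg u" if "fst C \<in> homogeneous a" for a
    using that u by (simp add: free_comp_iff)
  then have "deg C = c" unfolding cdeg_def using c by (intro the_equality) blast+
  then show ?thesis using c by simp
qed

lemma xmult_homogeneous:
  assumes "h \<in> homogeneous a" "keys \<beta> \<subseteq> X"
  shows "xmult \<beta> h \<in> homogeneous (int (mdeg \<beta>) + a)"
proof -
  have "(g, \<beta> + \<alpha>) \<in> {u \<in> monomials X G. mondeg u = int (mdeg \<beta>) + a}" if h: "(g, \<alpha>) \<in> supp h" for g \<alpha>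
  proof -
    have "(g, \<alpha>) \<in> {u \<in> monomials X G. mondeg u = a}" using assms(1) h by (auto simp: homogeneous_iff)
    moreover have "keys (\<beta> + \<alpha>) \<subseteq> X" if "keys \<alpha> \<subseteq> X" using that assms(2) keys_add[of \<beta> \<alpha>] by blast
    ultimately show ?thesis by (simp add: monomials_def mondeg_def mdeg_add)
  qed
  then show ?thesis by (auto simp: homogeneous_iff supp_xmult)
qed

lemma hcomp_homogeneous:
  assumes "f \<in> homogeneous a"
  shows "hcomp c f = (if a = c then f else 0)"
  using assms frestrict_cases[of f "{u. mondeg u = c}"] by (auto simp: hcomp_def homogeneous_iff)

lemma hcomp_linear:
  "hcomp c (kscale x f) = kscale x (hcomp c f)"
  "hcomp c (\<Sum>i\<in>I. h i) = (\<Sum>i\<in>I. hcomp c (h i))"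
  by (simp_all add: hcomp_def frestrict_linear)

section \<open>The monomial basis attached to a cone decomposition\<close>

text \<open>An index set for the vectors \<open>x^\<beta> h\<close> of degree \<open>c\<close> in
  the cones, not the set of these vectors: that they are distinct follows only from their
  independence.\<close>

definition cone_basis :: "int \<Rightarrow> ((('x, 'k, 'm) fvec \<times> 'x set) \<times> ('x \<Rightarrow>\<^sub>0 nat)) set" where
  "cone_basis c = (SIGMA C:P. {\<beta>. keys \<beta> \<subseteq> snd C \<and> int (mdeg \<beta>) + deg C = c})"

definition cone_vec :: "(('x, 'k, 'm) fvec \<times> 'x set) \<times> ('x \<Rightarrow>\<^sub>0 nat) \<Rightarrow> ('x, 'k, 'm) fvec" where
  "cone_vec i = xmult (snd i) (fst (fst i))"

lemma cone_exponents: "{\<beta>. keys \<beta> \<subseteq> U \<and> int (mdeg \<beta>) + a = c} = (if a \<le> c then exponents U (nat (c - a)) else {})"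
  by (auto simp: exponents_def)

lemma finite_cone_vars: "C \<in> P \<Longrightarrow> finite (snd C)"
  using cone_vars finite_vars finite_subset by blast

lemma finite_cone_basis: "finite (cone_basis c)"
  unfolding cone_basis_def cone_exponents using finite_P
  by (intro finite_SigmaI) (simp_all add: finite_exponents finite_cone_vars)

lemma cone_vec_in: "cone_vec ` cone_basis c \<subseteq> N \<inter> homogeneous c"
proof (rule image_subsetI)
  fix i assume "i \<in> cone_basis c"
  then obtain C \<beta> where i: "i = (C, \<beta>)" "C \<in> P" "keys \<beta> \<subseteq> snd C" "int (mdeg \<beta>) + deg C = c"
    by (auto simp: cone_basis_def)
  have "cone_vec i \<in> cone C"
    using single_in_poly_ring[OF i(3)] by (auto simp: i cone_vec_def cone_def xmult_def)
  moreover have "cone_vec i \<in> homogeneous (int (mdeg \<beta>) + deg C)"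
    using xmult_homogeneous[OF generator_in subset_trans[OF i(3) cone_vars]] i(2)
    by (simp add: i(1) cone_vec_def)
  ultimately show "cone_vec i \<in> N \<inter> homogeneous c" using cone_subset[OF i(2)] i(4) by blast
qed

text \<open>The summands \<open>w C\<close> of a homogeneous \<open>f\<close> are not known to be
  homogeneous. Since \<open>f\<close> equals its own component of degree \<open>c\<close>, taking
  that component of each summand keeps just the \<open>x^\<beta> h\<close> of degree
  \<open>c\<close>.\<close>

lemma cone_vec_spans: "N \<inter> homogeneous c \<subseteq> fvec.span (cone_vec ` cone_basis c)"
proof
  fix f assume f: "f \<in> N \<inter> homogeneous c"
  then obtain w where w: "w \<in> (\<Pi>\<^sub>E C\<in>P. cone C)" "f = (\<Sum>C\<in>P. w C)" using cone_sum by blast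
  have "hcomp c (w C) \<in> fvec.span (cone_vec ` cone_basis c)" if C: "C \<in> P" for C
  proof -
    obtain p where p: "p \<in> carrier (poly_ring (snd C))" "w C = fscale p (fst C)"
      using w(1) C by (auto simp: cone_def dest!: PiE_mem)
    have "hcomp c (xmult \<beta> (fst C)) \<in> fvec.span (cone_vec ` cone_basis c)" if "\<beta> \<in> keys p" for \<beta>
    proof -
      have \<beta>: "keys \<beta> \<subseteq> snd C" using that p(1) by (auto simp: carrier_poly_ring_iff)
      have "xmult \<beta> (fst C) \<in> homogeneous (int (mdeg \<beta>) + deg C)"
        using xmult_homogeneous[OF generator_in subset_trans[OF \<beta> cone_vars]] C by blast
      note hcomp_homogeneous[OF this, of c]
      moreover have "xmult \<beta> (fst C) \<in> cone_vec ` cone_basis c" if "int (mdeg \<beta>) + deg C = c"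
        using that C \<beta> by (force simp: cone_vec_def cone_basis_def)
      ultimately show ?thesis by (auto intro: fvec.span_base fvec.span_zero)
    qed
    then show ?thesis
      unfolding p(2) fscale_eq_sum[of p] hcomp_linear by (intro fvec.span_sum fvec.span_scale)
  qed
  moreover have "f = (\<Sum>C\<in>P. hcomp c (w C))"
    using f w(2) hcomp_homogeneous[of f c c] by (simp flip: hcomp_linear(2))
  ultimately show "f \<in> fvec.span (cone_vec ` cone_basis c)" by (auto intro: fvec.span_sum)
qed

text \<open>A relation is collected cone by cone into products of polynomials \<open>?p C\<close>
  with the generators. Uniqueness, applied to this and to the zero decomposition of 0, makes each
  product vanish; then \<open>fscale_eq_0D\<close> makes each \<open>?p C\<close> vanish, and its
  coefficients are the given scalars.\<close>

lemma cone_vec_independent: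
  assumes sum0: "(\<Sum>i\<in>cone_basis c. kscale (a i) (cone_vec i)) = 0" and i: "i \<in> cone_basis c"
  shows "a i = 0"
proof -
  let ?B = "\<lambda>C. {\<beta>. keys \<beta> \<subseteq> snd C \<and> int (mdeg \<beta>) + deg C = c}"
  let ?p = "\<lambda>C. \<Sum>\<beta>\<in>?B C. Poly_Mapping.single \<beta> (a (C, \<beta>))"
  have finB: "finite (?B C)" if "C \<in> P" for C
    using that finite_cone_vars by (simp add: cone_exponents finite_exponents)
  let ?w = "\<lambda>C\<in>P. fscale (?p C) (fst C)" and ?z = "\<lambda>C\<in>P. 0"
  have p_in: "?p C \<in> carrier (poly_ring (snd C))" for C
  proof -
    have "\<alpha> \<in> ?B C" if "\<alpha> \<in> keys (?p C)" for \<alpha>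
    proof -
      have "(\<Sum>\<beta>\<in>?B C. lookup (Poly_Mapping.single \<beta> (a (C, \<beta>))) \<alpha>) \<noteq> 0"
        using that by (simp only: in_keys_iff lookup_sum not_False_eq_True)
      then obtain \<beta> where "\<beta> \<in> ?B C" "lookup (Poly_Mapping.single \<beta> (a (C, \<beta>))) \<alpha> \<noteq> 0"
        by (rule sum.not_neutral_contains_not_neutral)
      moreover from this(2) have "\<beta> = \<alpha>" by (rule contrapos_np) (rule lookup_single_not_eq)
      ultimately show ?thesis by blast
    qed
    then show ?thesis unfolding carrier_poly_ring_iff by blast
  qed
  have "(\<Sum>C\<in>P. ?w C) = (\<Sum>C\<in>P. \<Sum>\<beta>\<in>?B C. kscale (a (C, \<beta>)) (cone_vec (C, \<beta>)))"
    by (simp add: fscale_sum fscale_single cone_vec_def)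
  also have "\<dots> = (\<Sum>i\<in>cone_basis c. kscale (a i) (cone_vec i))"
    unfolding cone_basis_def using finite_P finB by (subst sum.Sigma) auto
  finally have w0: "0 = (\<Sum>C\<in>P. ?w C)" using sum0 by simp
  have z0: "0 = (\<Sum>C\<in>P. ?z C)" by simp
  have w: "?w \<in> (\<Pi>\<^sub>E C\<in>P. cone C)" using p_in by (auto simp: cone_def)
  have "0 \<in> cone C" for C :: "('x, 'k, 'm) fvec \<times> 'x set"
    unfolding cone_def by (rule CollectI, rule exI[of _ 0]) (simp add: fscale_simps carrier_poly_ring_iff)
  then have z: "?z \<in> (\<Pi>\<^sub>E C\<in>P. cone C)" by auto
  have "0 \<in> N" by (simp add: N_iff)
  from cone_sum[OF this] have wz: "?w = ?z" using w z w0 z0 by blast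
  obtain C \<beta> where C: "i = (C, \<beta>)" "C \<in> P" "\<beta> \<in> ?B C" using i by (auto simp: cone_basis_def)
  have "fscale (?p C) (fst C) = 0" using fun_cong[OF wz, of C] C by simp
  moreover have "?p C \<in> carrier (poly_ring X)"
    using p_in[of C] cone_vars[OF C(2)] unfolding carrier_poly_ring_iff by blast
  ultimately have "?p C = 0"
    using fscale_eq_0D[of "?p C" "fst C"] generator_nonzero generator_in C(2) by (simp add: free_comp_iff)
  then have "lookup (?p C) \<beta> = 0" by simp
  then show "a i = 0"
    using C finB by (simp add: lookup_sum lookup_single when_def)
qed

lemma K_dim_eq_card_cone_basis: "K_dim M (Gr c) = card (cone_basis c)"
proof -
  have ind: "fvec.independent (cone_vec ` cone_basis c)"
    and card: "card (cone_vec ` cone_basis c) = card (cone_basis c)"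
    using fvec.dim_eq_card_family[of "cone_basis c" cone_vec "N \<inter> homogeneous c"]
      finite_cone_basis cone_vec_in cone_vec_spans cone_vec_independent by blast+
  have "K_dim M (Gr c) = card (cone_vec ` cone_basis c)"
    using finite_cone_basis
    by (intro linear_coordinates.K_dim_eq_card[OF linear_coordinates_\<phi>] cone_vec_in cone_vec_spans ind) auto
  then show ?thesis using card by simp
qed

section \<open>From dimensions of components to the Hilbert polynomial\<close>

text \<open>The strict bound on the degree makes a cone of dimension 0 contribute nothing. In
  positive dimension, symmetry of the binomial moves the dependence on \<open>c\<close> out of the
  lower index, which is what makes the count polynomial in \<open>c\<close>.\<close>

lemma card_cone_exponents:
  assumes "C \<in> P" "deg C < c"
  shows "(of_nat (card {\<beta>. keys \<beta> \<subseteq> snd C \<and> int (mdeg \<beta>) + deg C = c}) :: rat) =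
    (if card (snd C) = 0 then 0
     else poly (binom_poly (- deg C + int (card (snd C)) - 1) (card (snd C) - 1)) (of_int c))"
proof -
  let ?n = "nat (c - deg C)" and ?u = "card (snd C)"
  have card: "card {\<beta>. keys \<beta> \<subseteq> snd C \<and> int (mdeg \<beta>) + deg C = c} = (?u + ?n - 1) choose ?n"
    unfolding cone_exponents using assms(2) card_exponents[OF finite_cone_vars[OF assms(1)]] by simp
  show ?thesis
  proof (cases "?u = 0")
    case True
    then show ?thesis unfolding card using assms(2) by simp
  next
    case False
    then have "(?u + ?n - 1) choose ?n = (?u + ?n - 1) choose (?u - 1)"
      by (subst binomial_symmetric) (auto intro: arg_cong2[where f = binomial])
    moreover have "nat (c + (- deg C + int ?u - 1)) = ?u + ?n - 1"
      using assms(2) False by linarith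
    ultimately show ?thesis
      unfolding card using False assms(2) by (simp add: poly_binom_poly_of_int)
  qed
qed

lemma hilbert_poly_eq:
  assumes "macaulay_form X Gr G e d P b"
  shows "hilbert_poly M Gr =
    (\<Sum>j = 1..d. \<Sum>k\<in>{b (j + 1)..<b j}. binom_poly (- k + int j - 1) (j - 1))" (is "_ = ?p")
proof (rule hilbert_poly_eqI)
  have dims: "C \<in> P \<Longrightarrow> card (snd C) \<le> d" for C
    using assms by (auto simp: macaulay_form_def)
  have bij: "j \<in> {1..d} \<Longrightarrow> bij_betw deg {C \<in> P. card (snd C) = j} {b (j + 1)..<b j}" for j
    using assms by (auto simp: macaulay_form_def)
  have "poly ?p (of_int c) = of_nat (K_dim M (Gr c))" if c: "\<And>C. C \<in> P \<Longrightarrow> deg C < c" for c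
  proof -
    let ?f = "\<lambda>C. poly (binom_poly (- deg C + int (card (snd C)) - 1) (card (snd C) - 1)) (of_int c)"
    let ?P = "{C \<in> P. card (snd C) \<noteq> 0}"
    let ?B = "\<lambda>C. {\<beta>. keys \<beta> \<subseteq> snd C \<and> int (mdeg \<beta>) + deg C = c}"
    have "card (cone_basis c) = (\<Sum>C\<in>P. card (?B C))"
      unfolding cone_basis_def using finite_P
      by (intro card_SigmaI) (simp_all add: cone_exponents finite_exponents finite_cone_vars)
    then have "of_nat (K_dim M (Gr c)) = (\<Sum>C\<in>P. of_nat (card (?B C)) :: rat)"
      by (simp only: K_dim_eq_card_cone_basis of_nat_sum)
    also have "\<dots> = (\<Sum>C\<in>P. if card (snd C) = 0 then 0 else ?f C)"
      by (intro sum.cong refl card_cone_exponents c)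
    also have "\<dots> = (\<Sum>C\<in>?P. ?f C)"
      using finite_P by (intro sum.mono_neutral_cong_right) auto
    \<comment> \<open>Cones are grouped by dimension. Below, the bijection in
      \<open>macaulay_form\<close> replaces the cones of one dimension by their degrees.\<close>
    also have "\<dots> = (\<Sum>j = 1..d. \<Sum>C\<in>{C \<in> ?P. card (snd C) = j}. ?f C)"
      using finite_P dims by (intro sum.group[symmetric]) (auto simp: Suc_le_eq)
    also have "\<dots> = (\<Sum>j = 1..d. \<Sum>k\<in>{b (j + 1)..<b j}. poly (binom_poly (- k + int j - 1) (j - 1)) (of_int c))"
    proof (rule sum.cong[OF refl])
      fix j assume j: "j \<in> {1..d}"
      have "(\<Sum>C\<in>{C \<in> ?P. card (snd C) = j}. ?f C) =
          (\<Sum>C\<in>{C \<in> P. card (snd C) = j}. poly (binom_poly (- deg C + int j - 1) (j - 1)) (of_int c))"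
        using j by (intro sum.cong) auto
      also have "\<dots> = (\<Sum>k\<in>{b (j + 1)..<b j}. poly (binom_poly (- k + int j - 1) (j - 1)) (of_int c))"
        by (rule sum.reindex_bij_betw[OF bij[OF j]])
      finally show "(\<Sum>C\<in>{C \<in> ?P. card (snd C) = j}. ?f C) = \<dots>" .
    qed
    finally show ?thesis by (simp add: poly_sum)
  qed
  moreover have "\<forall>\<^sub>F c in at_top. \<forall>C\<in>P. deg C < c"
    using finite_P by (intro eventually_ball_finite) (auto intro: eventually_gt_at_top)
  ultimately show "\<forall>\<^sub>F c in at_top. poly ?p (of_int c) = of_nat (K_dim M (Gr c))"
    by (auto elim: eventually_mono)
qed

end

text \<open>The dimension is hidden inside \<open>macaulay_constants\<close>. It is exposed together
  with the values of \<open>b\<close> beyond it, so that two modules can be compared without a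
  common dimension given in advance.\<close>

lemma hilbert_poly_macaulay_constants:
  assumes "graded_module X M Gr" "macaulay_constants X M Gr b"
  obtains d where "module_dim (poly_ring X) M = enat d"
    and "\<And>j. j > d \<Longrightarrow> b j = e_plus X M Gr"
    and "hilbert_poly M Gr =
      (\<Sum>j = 1..d. \<Sum>k\<in>{b (j + 1)..<b j}. binom_poly (- k + int j - 1) (j - 1))"
    and "hilbert_poly M Gr = (\<Sum>j = 1..d. mbinom j (e_plus X M Gr) - mbinom j (b j))"
proof -
  obtain G r P d where *: "minimal_hom_gens X M Gr G" "monomial_order X G r"
    "cone_decomposition X M Gr G r P" "module_dim (poly_ring X) M = enat d"
    and form: "macaulay_form X Gr G (e_plus X M Gr) d P b"
    using assms(2) by (auto simp: macaulay_constants_def)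
  interpret graded_module X M Gr by (rule assms(1))
  interpret macaulay_cones X M Gr G r P
    by unfold_locales (fact *)+
  have mono: "b (j + 1) \<le> b j" if "j \<in> {1..d}" for j
    using form that by (auto simp: macaulay_form_def)
  have top: "b j = e_plus X M Gr" if "j > d" for j
    using form that by (auto simp: macaulay_form_def)
  note eq = hilbert_poly_eq[OF form]
  also have "(\<Sum>j = 1..d. \<Sum>k\<in>{b (j + 1)..<b j}. binom_poly (- k + int j - 1) (j - 1)) =
      (\<Sum>j = 1..d. mbinom j (b (j + 1) - 1) - mbinom j (b j - 1))"
    using mono by (intro sum.cong refl sum_binom_poly_eq_mbinom) auto
  \<comment> \<open>The common base value left by the shift is \<open>b (d + 1)\<close>, which is
    \<open>e_plus X M Gr\<close>.\<close>
  also have "\<dots> = (\<Sum>j = 1..d. mbinom j (e_plus X M Gr) - mbinom j (b j))"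
    using top[of "d + 1"] by (simp only: sum_mbinom_shift less_add_one)
  finally show thesis using that *(4) top eq by blast
qed

theorem proposition3p1:
  fixes X :: "'x set"
    and M :: "(('x, 'k::field) mpoly, 'm) module"
    and Gr :: "int \<Rightarrow> 'm set"
    and d :: nat
    and b :: "nat \<Rightarrow> int"
  assumes "graded_module X M Gr"
    and "finitely_generated (poly_ring X) M"
    and "carrier M \<noteq> {\<zero>\<^bsub>M\<^esub>}"
    and "module_dim (poly_ring X) M = enat d"
    and "macaulay_constants X M Gr b"
  shows "hilbert_poly M Gr =
        (\<Sum>j = 1..d. \<Sum>k\<in>{b (j + 1)..<b j}. binom_poly (- k + int j - 1) (j - 1)) \<and>
      hilbert_poly M Gr =
        (\<Sum>j = 1..d. binom_poly (- e_plus X M Gr + int j - 1) j - binom_poly (- b j + int j - 1) j) \<and>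
      (1 \<le> d \<longrightarrow>
        (\<forall>(M' :: (('x, 'k) mpoly, 'n) module) Gr' b'.
          graded_module X M' Gr' \<and>
          finitely_generated (poly_ring X) M' \<and>
          carrier M' \<noteq> {\<zero>\<^bsub>M'\<^esub>} \<and>
          macaulay_constants X M' Gr' b' \<and>
          e_plus X M' Gr' = e_plus X M Gr \<and>
          hilbert_poly M' Gr' = hilbert_poly M Gr \<longrightarrow>
          (\<forall>i\<in>{1..d}. b' i = b i)))"
proof -
  let ?e = "e_plus X M Gr"
  obtain d0 where "module_dim (poly_ring X) M = enat d0"
    and "\<And>j. j > d0 \<Longrightarrow> b j = ?e"
    and "hilbert_poly M Gr =
      (\<Sum>j = 1..d0. \<Sum>k\<in>{b (j + 1)..<b j}. binom_poly (- k + int j - 1) (j - 1))"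
    and "hilbert_poly M Gr = (\<Sum>j = 1..d0. mbinom j ?e - mbinom j (b j))"
    using hilbert_poly_macaulay_constants[OF assms(1,5)] by blast
  moreover from this(1) have "d0 = d" using assms(4) by simp
  ultimately have top: "\<And>j. j > d \<Longrightarrow> b j = ?e"
    and eq: "hilbert_poly M Gr =
      (\<Sum>j = 1..d. \<Sum>k\<in>{b (j + 1)..<b j}. binom_poly (- k + int j - 1) (j - 1))"
    and eq': "hilbert_poly M Gr = (\<Sum>j = 1..d. mbinom j ?e - mbinom j (b j))" by blast+
  have uniq: "b' i = b i"
    if M': "graded_module X M' Gr'" "macaulay_constants X M' Gr' b'" "e_plus X M' Gr' = ?e"
      "hilbert_poly M' Gr' = hilbert_poly M Gr" and i: "i \<in> {1..d}"
    for M' :: "(('x, 'k) mpoly, 'n) module" and Gr' b' i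
  proof -
    obtain d' where top': "\<And>j. j > d' \<Longrightarrow> b' j = ?e"
      and eq'': "hilbert_poly M' Gr' = (\<Sum>j = 1..d'. mbinom j ?e - mbinom j (b' j))"
      using hilbert_poly_macaulay_constants[OF M'(1,2)] M'(3) by metis
    \<comment> \<open>The dimensions \<open>d\<close> and \<open>d'\<close> may differ a priori.
      Beyond its own dimension each module has all constants equal to \<open>?e\<close>, so the
      summands vanish there and both sums extend to \<open>?n\<close>.\<close>
    let ?n = "max d d'"
    have "(\<Sum>j = 1..?n. mbinom j ?e - mbinom j (b j)) = hilbert_poly M Gr"
      unfolding eq' using top by (intro sum.mono_neutral_right) auto
    also have "\<dots> = (\<Sum>j = 1..?n. mbinom j ?e - mbinom j (b' j))"
      unfolding M'(4)[symmetric] eq'' using top' by (intro sum.mono_neutral_left) auto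
    finally have "(\<Sum>j = 1..?n. mbinom j (b' j)) = (\<Sum>j = 1..?n. mbinom j (b j))"
      by (simp add: sum_subtractf)
    then show ?thesis by (rule sum_mbinom_inject) (use i in auto)
  qed
  show ?thesis
    by (intro conjI impI allI ballI eq eq'[unfolded mbinom_def]; elim conjE; rule uniq; assumption)
qed

end
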